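(* The representation $\pi$ maps $\mathcal E(\mathfrak A)$ into $\mathcal E(\mathfrak B)$, and for every normal state $\omega_p\in S_*(\mathfrak A)$ and every effect $e\in\mathcal E(\mathfrak A)$ with $\omega_p e\neq 0$, $$\Gamma(\omega_p|_e)=(\Gamma\omega_p)|_{\pi e}.$$
   Context: Let $X$ be a completely metrizable, separable space with a Borel probability measure $\mu$ (ergodic and invariant under a dynamical flow $\Phi^t:X\to X$, $t\in\mathbb R$). Put $H=L^2(X,\mu)$, $\langle f,g\rangle=\int_X f^*g\,d\mu$; $\mathfrak A=L^\infty(X,\mu)$ with predual $\mathfrak A_*=L^1(X,\mu)$; $\mathfrak B=B(H)$ with predual $\mathfrak B_*=B_1(H)$ (trace-class operators). A probability density is $p\in\mathfrak A_*$ with $p\ge0$, $\int_Xp\,d\mu=1$; it induces the normal state $\omega_pf=\int_Xfp\,d\mu$. A density operator is a positive $\rho\in\mathfrak B_*$ with $\operatorname{tr}\rho=1$; it induces the normal state $\omega_\rho A=\operatorname{tr}(\rho A)$. $S_*(\mathfrak A)$ and $S_*(\mathfrak B)$ are the sets of normal states. $\pi:\mathfrak A\to\mathfrak B$ maps $f$ to the multiplication operator $(\pi f)g=fg$. $\Gamma:S_*(\mathfrak A)\to S_*(\mathfrak B)$ is $\Gamma(\omega_p)=\omega_\rho$ with $\rho=\langle\sqrt p,\cdot\rangle\sqrt p$. For a unital $C^*$-algebra $\mathfrak W$ with unit $I$, an effect is $e\in\mathfrak W$ with $0\le e\le I$; the set of effects is $\mathcal E(\mathfrak W)$. For a von Neumann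 algebra $\mathfrak W$ (here $\mathfrak A$ or $\mathfrak B$), a normal state $\omega_\rho$ induced by $\rho\in\mathfrak W_*$, and an effect $e$ with nonzero validity $\omega_\rho e\ne0$, the conditional state $\omega_\rho|_e$ is the normal state induced by $$\rho|_e=\frac{\sqrt e\,\rho\,\sqrt e}{\omega_\rho e}.$$ *)

theory Defs
  imports "HOL-Probability.Probability" "HOL-Algebra.Ring"
begin

section \<open>Star algebras, effects and conditional states\<close>

record 'a star_ring = "'a ring" +
  star :: "'a \<Rightarrow> 'a"

text \<open>The order, the effects and the square root of a unital \<open>C\<^sup>*\<close>-algebra depend only on its
  \<open>*\<close>-ring structure, so neither the scalars nor the norm are part of the record.\<close>

definition positives :: "('a, 'm) star_ring_scheme \<Rightarrow> 'a set" where
  "positives W = {star W b \<otimes>\<^bsub>W\<^esub> b | b. b \<in> carrier W}"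

definition alg_le :: "('a, 'm) star_ring_scheme \<Rightarrow> 'a \<Rightarrow> 'a \<Rightarrow> bool" where
  "alg_le W a b \<longleftrightarrow> a \<in> carrier W \<and> b \<in> carrier W \<and> b \<ominus>\<^bsub>W\<^esub> a \<in> positives W"

definition effects :: "('a, 'm) star_ring_scheme \<Rightarrow> 'a set" where
  "effects W = {e \<in> carrier W. alg_le W \<zero>\<^bsub>W\<^esub> e \<and> alg_le W e \<one>\<^bsub>W\<^esub>}"

definition pos_sqrt :: "('a, 'm) star_ring_scheme \<Rightarrow> 'a \<Rightarrow> 'a" where
  "pos_sqrt W a = (THE b. b \<in> positives W \<and> b \<otimes>\<^bsub>W\<^esub> b = a)"

text \<open>A von Neumann algebra together with its predual \<open>'p\<close>: the normalized positive elements of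
  the predual, the pairing of the predual with the algebra, the two module actions of the algebra
  on the predual, and the scalar multiplication of the predual.\<close>

record ('a, 'p) vn_algebra = "'a star_ring" +
  densities :: "'p set"
  pairing :: "'p \<Rightarrow> 'a \<Rightarrow> complex"
  lact :: "'a \<Rightarrow> 'p \<Rightarrow> 'p"
  ract :: "'p \<Rightarrow> 'a \<Rightarrow> 'p"
  pscale :: "complex \<Rightarrow> 'p \<Rightarrow> 'p"

text \<open>States are functionals that are \<open>undefined\<close> off the carrier, so that equality of states is
  equality on the algebra.\<close>

definition induced_state :: "('a, 'p, 'm) vn_algebra_scheme \<Rightarrow> 'p \<Rightarrow> 'a \<Rightarrow> complex" where
  "induced_state W \<rho> = (\<lambda>a\<in>carrier W. pairing W \<rho> a)"

definition normal_states :: "('a, 'p, 'm) vn_algebra_scheme \<Rightarrow> ('a \<Rightarrow> complex) set" where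
  "normal_states W = induced_state W ` densities W"

definition density_of :: "('a, 'p, 'm) vn_algebra_scheme \<Rightarrow> ('a \<Rightarrow> complex) \<Rightarrow> 'p" where
  "density_of W \<omega> = (THE \<rho>. \<rho> \<in> densities W \<and> induced_state W \<rho> = \<omega>)"

definition cond_density :: "('a, 'p, 'm) vn_algebra_scheme \<Rightarrow> 'p \<Rightarrow> 'a \<Rightarrow> 'p" where
  "cond_density W \<rho> e =
     pscale W (1 / induced_state W \<rho> e) (ract W (lact W (pos_sqrt W e) \<rho>) (pos_sqrt W e))"

definition cond_state ::
  "('a, 'p, 'm) vn_algebra_scheme \<Rightarrow> ('a \<Rightarrow> complex) \<Rightarrow> 'a \<Rightarrow> 'a \<Rightarrow> complex" where
  "cond_state W \<omega> e = induced_state W (cond_density W (density_of W \<omega>) e)"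


section \<open>Bounded and trace-class operators\<close>

record 'h inner_space = "'h partial_object" +
  vzero :: "'h"
  vadd :: "'h \<Rightarrow> 'h \<Rightarrow> 'h"
  vscale :: "complex \<Rightarrow> 'h \<Rightarrow> 'h"
  vinner :: "'h \<Rightarrow> 'h \<Rightarrow> complex"

definition vnorm :: "('h, 'm) inner_space_scheme \<Rightarrow> 'h \<Rightarrow> real" where
  "vnorm H x = sqrt (Re (vinner H x x))"

definition bounded_ops :: "('h, 'm) inner_space_scheme \<Rightarrow> ('h \<Rightarrow> 'h) set" where
  "bounded_ops H = {A \<in> carrier H \<rightarrow>\<^sub>E carrier H.
     (\<forall>x\<in>carrier H. \<forall>y\<in>carrier H. A (vadd H x y) = vadd H (A x) (A y)) \<and>
     (\<forall>c. \<forall>x\<in>carrier H. A (vscale H c x) = vscale H c (A x)) \<and>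
     (\<exists>C. \<forall>x\<in>carrier H. vnorm H (A x) \<le> C * vnorm H x)}"

definition op_adjoint :: "('h, 'm) inner_space_scheme \<Rightarrow> ('h \<Rightarrow> 'h) \<Rightarrow> 'h \<Rightarrow> 'h" where
  "op_adjoint H A = (THE B. B \<in> bounded_ops H \<and>
     (\<forall>x\<in>carrier H. \<forall>y\<in>carrier H. vinner H (B x) y = vinner H x (A y)))"

definition op_star_ring :: "('h, 'm) inner_space_scheme \<Rightarrow> ('h \<Rightarrow> 'h) star_ring" where
  "op_star_ring H =
    \<lparr>carrier = bounded_ops H,
     monoid.mult = compose (carrier H),
     one = (\<lambda>x\<in>carrier H. x),
     zero = (\<lambda>x\<in>carrier H. vzero H),
     add = (\<lambda>A B. \<lambda>x\<in>carrier H. vadd H (A x) (B x)),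
     star = op_adjoint H\<rparr>"

definition hilbert_basis :: "('h, 'm) inner_space_scheme \<Rightarrow> 'h set \<Rightarrow> bool" where
  "hilbert_basis H E \<longleftrightarrow> E \<subseteq> carrier H \<and>
     (\<forall>x\<in>E. \<forall>y\<in>E. vinner H x y = (if x = y then 1 else 0)) \<and>
     (\<forall>x\<in>carrier H. (\<forall>y\<in>E. vinner H y x = 0) \<longrightarrow> x = vzero H)"

definition trace_class :: "('h, 'm) inner_space_scheme \<Rightarrow> ('h \<Rightarrow> 'h) set" where
  "trace_class H = {A \<in> bounded_ops H. \<exists>E. hilbert_basis H E \<and>
     (\<lambda>x. vinner H x (pos_sqrt (op_star_ring H) (compose (carrier H) (op_adjoint H A) A) x))
       summable_on E}"

text \<open>On trace-class operators the sum does not depend on the chosen orthonormal basis.\<close>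

definition op_trace :: "('h, 'm) inner_space_scheme \<Rightarrow> ('h \<Rightarrow> 'h) \<Rightarrow> complex" where
  "op_trace H A = (\<Sum>\<^sub>\<infinity>x\<in>(SOME E. hilbert_basis H E). vinner H x (A x))"

definition op_algebra :: "('h, 'm) inner_space_scheme \<Rightarrow> ('h \<Rightarrow> 'h, 'h \<Rightarrow> 'h) vn_algebra" where
  "op_algebra H = star_ring.extend (op_star_ring H) (vn_algebra.fields
     {\<rho> \<in> trace_class H. \<rho> \<in> positives (op_star_ring H) \<and> op_trace H \<rho> = 1}
     (\<lambda>\<rho> A. op_trace H (compose (carrier H) \<rho> A))
     (compose (carrier H))
     (compose (carrier H))
     (\<lambda>c A. \<lambda>x\<in>carrier H. vscale H c (A x)))"


section \<open>The spaces \<open>L\<^sup>1\<close>, \<open>L\<^sup>2\<close> and \<open>L\<^sup>\<infinity>\<close>\<close>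

text \<open>Elements of these spaces are classes of measurable functions modulo equality almost
  everywhere. Operations act on representatives; the almost-everywhere class of the result does
  not depend on their choice.\<close>

type_synonym 'x fclass = "('x \<Rightarrow> complex) set"

definition ae_class :: "'x measure \<Rightarrow> ('x \<Rightarrow> complex) \<Rightarrow> 'x fclass" where
  "ae_class M f = {g \<in> borel_measurable M. AE x in M. g x = f x}"

definition repr :: "'x fclass \<Rightarrow> 'x \<Rightarrow> complex" where
  "repr F = (SOME f. f \<in> F)"

definition L1 :: "'x measure \<Rightarrow> 'x fclass set" where
  "L1 M = {ae_class M f | f. integrable M f}"

definition L2 :: "'x measure \<Rightarrow> 'x fclass set" where
  "L2 M = {ae_class M f | f. f \<in> borel_measurable M \<and> integrable M (\<lambda>x. (cmod (f x))\<^sup>2)}"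

definition Linf :: "'x measure \<Rightarrow> 'x fclass set" where
  "Linf M = {ae_class M f | f. f \<in> borel_measurable M \<and> (\<exists>C. AE x in M. cmod (f x) \<le> C)}"

definition cls_add :: "'x measure \<Rightarrow> 'x fclass \<Rightarrow> 'x fclass \<Rightarrow> 'x fclass" where
  "cls_add M F G = ae_class M (\<lambda>x. repr F x + repr G x)"

definition cls_mult :: "'x measure \<Rightarrow> 'x fclass \<Rightarrow> 'x fclass \<Rightarrow> 'x fclass" where
  "cls_mult M F G = ae_class M (\<lambda>x. repr F x * repr G x)"

definition cls_scale :: "'x measure \<Rightarrow> complex \<Rightarrow> 'x fclass \<Rightarrow> 'x fclass" where
  "cls_scale M c F = ae_class M (\<lambda>x. c * repr F x)"

definition cls_cnj :: "'x measure \<Rightarrow> 'x fclass \<Rightarrow> 'x fclass" where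
  "cls_cnj M F = ae_class M (\<lambda>x. cnj (repr F x))"

text \<open>The pointwise square root, for classes of nonnegative functions.\<close>

definition cls_sqrt :: "'x measure \<Rightarrow> 'x fclass \<Rightarrow> 'x fclass" where
  "cls_sqrt M F = ae_class M (\<lambda>x. complex_of_real (sqrt (Re (repr F x))))"

definition L2_space :: "'x measure \<Rightarrow> 'x fclass inner_space" where
  "L2_space M =
    \<lparr>carrier = L2 M,
     vzero = ae_class M (\<lambda>_. 0),
     vadd = cls_add M,
     vscale = cls_scale M,
     vinner = (\<lambda>F G. LINT x|M. cnj (repr F x) * repr G x)\<rparr>"

definition Linf_algebra :: "'x measure \<Rightarrow> ('x fclass, 'x fclass) vn_algebra" where
  "Linf_algebra M =
    \<lparr>carrier = Linf M,
     monoid.mult = cls_mult M,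
     one = ae_class M (\<lambda>_. 1),
     zero = ae_class M (\<lambda>_. 0),
     add = cls_add M,
     star = cls_cnj M,
     densities = {p \<in> L1 M. (AE x in M. repr p x \<in> \<real>\<^sub>\<ge>\<^sub>0) \<and> (LINT x|M. repr p x) = 1},
     pairing = (\<lambda>p f. LINT x|M. repr f x * repr p x),
     lact = cls_mult M,
     ract = cls_mult M,
     pscale = cls_scale M\<rparr>"

abbreviation BL2_algebra ::
  "'x measure \<Rightarrow> ('x fclass \<Rightarrow> 'x fclass, 'x fclass \<Rightarrow> 'x fclass) vn_algebra" where
  "BL2_algebra M \<equiv> op_algebra (L2_space M)"


section \<open>The multiplication representation and the embedding of states\<close>

definition mult_rep :: "'x measure \<Rightarrow> 'x fclass \<Rightarrow> 'x fclass \<Rightarrow> 'x fclass" where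
  "mult_rep M f = (\<lambda>g\<in>L2 M. cls_mult M f g)"

definition rank_one :: "('h, 'm) inner_space_scheme \<Rightarrow> 'h \<Rightarrow> 'h \<Rightarrow> 'h" where
  "rank_one H \<xi> = (\<lambda>g\<in>carrier H. vscale H (vinner H \<xi> g) \<xi>)"

definition state_embedding ::
  "'x measure \<Rightarrow> ('x fclass \<Rightarrow> complex) \<Rightarrow> ('x fclass \<Rightarrow> 'x fclass) \<Rightarrow> complex" where
  "state_embedding M \<omega> = induced_state (BL2_algebra M)
     (rank_one (L2_space M) (cls_sqrt M (density_of (Linf_algebra M) \<omega>)))"


section \<open>Ergodic measure-preserving flows\<close>

definition ergodic_flow :: "'x measure \<Rightarrow> (real \<Rightarrow> 'x \<Rightarrow> 'x) \<Rightarrow> bool" where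
  "ergodic_flow M \<Phi> \<longleftrightarrow>
     \<Phi> 0 = id \<and> (\<forall>s t. \<Phi> (s + t) = \<Phi> s \<circ> \<Phi> t) \<and>
     (\<forall>t. \<Phi> t \<in> measurable M M \<and> distr M M (\<Phi> t) = M) \<and>
     (\<forall>A\<in>sets M. (\<forall>t. \<Phi> t -` A \<inter> space M = A) \<longrightarrow> measure M A = 0 \<or> measure M A = 1)"

end

theory Submission
  imports Defs
begin

text \<open>Let \<open>p\<close> be a probability density, \<open>e\<close> an effect and \<open>r = \<omega>\<^sub>p e\<close>. In \<open>L\<^sup>\<infinity>\<close> the conditional density
  is \<open>q = e p / r\<close>, which the embedding sends to the projection onto the unit vector
  \<open>sqrt q = sqrt e * sqrt p / sqrt r\<close>. Among the operators, conditioning the projection onto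
  \<open>\<xi> = sqrt p\<close> on an effect with root \<open>S\<close> and validity \<open>r\<close> gives the projection onto \<open>S \<xi> / sqrt r\<close>
  (\<open>cond_density_rank_one\<close>). The effect is \<open>\<pi> e\<close>, its root is multiplication by \<open>sqrt e\<close>
  (\<open>pos_sqrt_mult_rep\<close>), and the two vectors are equal. The representation \<open>\<pi>\<close> preserves effects
  because it is a unital star homomorphism and order is defined through elements \<open>b\<^sup>* b\<close>.

  The work lies in showing that roots, adjoints and the density of a state, which are definite
  descriptions, denote what they should.

  \<^item> A normal state determines its density: for functions by a suitable bounded test function
    (\<open>Linf_induced_state_inj\<close>), for operators because the trace against \<open>|u\<rangle>\<langle>v|\<close> is a matrix element,
    by Parseval (\<open>op_trace_ketbra\<close>, \<open>induced_state_inj\<close>).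

  \<^item> A positive root of \<open>\<pi> e\<close> commutes with \<open>\<pi> e\<close>, hence by polynomial approximation with
    \<open>\<pi> (sqrt e)\<close> (\<open>commutes_with_sqrt\<close>), and commuting positive roots of the same operator are
    equal (\<open>commuting_positive_roots_eq\<close>).

  \<^item> Parseval's identity, orthonormal bases and adjoints come from the Riesz-Fischer construction
    (\<open>Riesz_Fischer\<close>), which rests on the completeness of \<open>L\<^sup>2\<close> (\<open>sq_integrable_fast_limit\<close>).\<close>

section \<open>Hilbert spaces on a carrier\<close>

lemma of_real_cmod_sq: "(complex_of_real (cmod z))\<^sup>2 = z * cnj z"
  using complex_norm_square[of z] by simp

text \<open>Vectors are told apart by their inner products (\<open>vinner_ext\<close>), so every identity between vectors,
  the vector space laws included, follows from the rules that evaluate \<open>vinner\<close>. Completeness is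
  asked for in the form in which it is used and is easiest to verify for \<open>L\<^sup>2\<close>: a sequence with
  geometrically decreasing steps has a weak limit.\<close>

locale hilbert_carrier =
  fixes H :: "('h, 'm) inner_space_scheme"
  assumes vzero_closed [simp]: "vzero H \<in> carrier H"
    and vadd_closed [simp]: "x \<in> carrier H \<Longrightarrow> y \<in> carrier H \<Longrightarrow> vadd H x y \<in> carrier H"
    and vscale_closed [simp]: "x \<in> carrier H \<Longrightarrow> vscale H c x \<in> carrier H"
    and vinner_zero [simp]: "x \<in> carrier H \<Longrightarrow> vinner H x (vzero H) = 0"
    and vinner_add [simp]: "x \<in> carrier H \<Longrightarrow> y \<in> carrier H \<Longrightarrow> z \<in> carrier H \<Longrightarrow>
      vinner H x (vadd H y z) = vinner H x y + vinner H x z"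
    and vinner_scale [simp]: "x \<in> carrier H \<Longrightarrow> y \<in> carrier H \<Longrightarrow>
      vinner H x (vscale H c y) = c * vinner H x y"
    and vinner_cnj: "x \<in> carrier H \<Longrightarrow> y \<in> carrier H \<Longrightarrow> vinner H y x = cnj (vinner H x y)"
    and vinner_nonneg: "x \<in> carrier H \<Longrightarrow> 0 \<le> Re (vinner H x x)"
    and vinner_ext: "x \<in> carrier H \<Longrightarrow> y \<in> carrier H \<Longrightarrow>
      (\<And>z. z \<in> carrier H \<Longrightarrow> vinner H z x = vinner H z y) \<Longrightarrow> x = y"
    and fast_cauchy_weak_limit: "(\<And>n. X n \<in> carrier H) \<Longrightarrow>
      (\<And>n. vnorm H (vadd H (X (Suc n)) (vscale H (-1) (X n))) \<le> (1/4) ^ n) \<Longrightarrow>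
      \<exists>y\<in>carrier H. \<forall>z\<in>carrier H. (\<lambda>n. vinner H z (X n)) \<longlonglongrightarrow> vinner H z y"
begin

lemma vinner_zero_left [simp]: "x \<in> carrier H \<Longrightarrow> vinner H (vzero H) x = 0"
  by (subst vinner_cnj) auto

lemma vinner_add_left [simp]: "x \<in> carrier H \<Longrightarrow> y \<in> carrier H \<Longrightarrow> z \<in> carrier H \<Longrightarrow>
    vinner H (vadd H y z) x = vinner H y x + vinner H z x"
  using vinner_cnj[of x "vadd H y z"] vinner_cnj[of x y] vinner_cnj[of x z] by simp

lemma vinner_scale_left [simp]: "x \<in> carrier H \<Longrightarrow> y \<in> carrier H \<Longrightarrow>
    vinner H (vscale H c y) x = cnj c * vinner H y x"
  using vinner_cnj[of x "vscale H c y"] vinner_cnj[of x y] by simp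

lemma vinner_self: "x \<in> carrier H \<Longrightarrow> vinner H x x = complex_of_real (Re (vinner H x x))"
  using vinner_cnj[of x x] by (simp add: complex_eq_iff)

lemma vnorm_sq: "x \<in> carrier H \<Longrightarrow> (vnorm H x)\<^sup>2 = Re (vinner H x x)"
  by (simp add: vnorm_def vinner_nonneg)

lemma vnorm_nonneg: "x \<in> carrier H \<Longrightarrow> 0 \<le> vnorm H x"
  by (simp add: vnorm_def vinner_nonneg)

lemma Cauchy_Schwarz:
  assumes x: "x \<in> carrier H" and y: "y \<in> carrier H"
  shows "cmod (vinner H x y) \<le> vnorm H x * vnorm H y"
proof -
  define a b k where "a = Re (vinner H x x)" and "b = Re (vinner H y y)"
    and "k = (cmod (vinner H x y))\<^sup>2"
  have nonneg: "0 \<le> a" "0 \<le> b" "0 \<le> k"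
    using x y by (auto simp: a_def b_def k_def vinner_nonneg)
  have quad: "0 \<le> a - 2 * s * k + s\<^sup>2 * k * b" for s :: real
  proof -
    define t where "t = - complex_of_real s * cnj (vinner H x y)"
    have k: "vinner H x y * cnj (vinner H x y) = of_real k"
      by (simp add: k_def of_real_cmod_sq)
    have "vinner H (vadd H x (vscale H t y)) (vadd H x (vscale H t y)) =
        vinner H x x + t * vinner H x y + cnj t * vinner H y x + cnj t * t * vinner H y y"
      using x y by (simp add: algebra_simps)
    also have "\<dots> = of_real a - 2 * of_real s * of_real k + of_real (s\<^sup>2 * k * b)"
      using vinner_self[OF x] vinner_self[OF y] vinner_cnj[OF x y] k
      by (simp add: t_def a_def[symmetric] b_def[symmetric] power2_eq_square algebra_simps)
    also have "\<dots> = of_real (a - 2 * s * k + s\<^sup>2 * k * b)"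
      by simp
    finally show ?thesis
      using vinner_nonneg[of "vadd H x (vscale H t y)"] x y by simp
  qed
  have "k \<le> a * b"
  proof (cases "b = 0")
    case True
    \<comment> \<open>The quadratic in \<open>s\<close> degenerates to a line, which is bounded below only if it is constant.\<close>
    have "k = 0"
    proof (rule ccontr)
      assume "k \<noteq> 0"
      with quad[of "(a + 1) / (2 * k)"] True show False by (simp add: field_simps)
    qed
    with nonneg show ?thesis by simp
  next
    case False
    with quad[of "1 / b"] nonneg show ?thesis
      by (simp add: field_simps power2_eq_square)
  qed
  hence "(cmod (vinner H x y))\<^sup>2 \<le> (vnorm H x * vnorm H y)\<^sup>2"
    using x y by (simp add: k_def a_def b_def power_mult_distrib vnorm_sq)
  thus ?thesis
    by (rule power2_le_imp_le) (use x y in \<open>simp add: vnorm_nonneg\<close>)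
qed

lemma vnorm_vscale:
  assumes x: "x \<in> carrier H"
  shows "vnorm H (vscale H c x) = cmod c * vnorm H x"
proof -
  have "vinner H (vscale H c x) (vscale H c x) = of_real ((cmod c)\<^sup>2) * vinner H x x"
    using x by (simp add: of_real_cmod_sq mult_ac)
  hence "Re (vinner H (vscale H c x) (vscale H c x)) = (cmod c)\<^sup>2 * Re (vinner H x x)"
    by simp
  hence "(vnorm H (vscale H c x))\<^sup>2 = (cmod c * vnorm H x)\<^sup>2"
    using x by (simp only: vnorm_sq power_mult_distrib vscale_closed)
  thus ?thesis
    using x by (simp add: vnorm_nonneg power2_eq_iff_nonneg)
qed

lemma vinner_definite:
  assumes "x \<in> carrier H" "vinner H x x = 0"
  shows "x = vzero H"
proof (rule vinner_ext)
  fix z assume "z \<in> carrier H"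
  with Cauchy_Schwarz[of z x] assms show "vinner H z x = vinner H z (vzero H)"
    by (simp add: vnorm_def)
qed (use assms in auto)

lemma vadd_diff_zeroD:
  assumes "x \<in> carrier H" "y \<in> carrier H" "vadd H x (vscale H (-1) y) = vzero H"
  shows "x = y"
proof (rule vinner_ext)
  fix z assume z: "z \<in> carrier H"
  have "vinner H z (vadd H x (vscale H (-1) y)) = 0"
    using assms z by simp
  thus "vinner H z x = vinner H z y"
    using assms(1,2) z by simp
qed (use assms in auto)

section \<open>Bounded operators\<close>

lemma bounded_opD:
  assumes "A \<in> bounded_ops H"
  shows "x \<in> carrier H \<Longrightarrow> A x \<in> carrier H"
    and "x \<in> carrier H \<Longrightarrow> y \<in> carrier H \<Longrightarrow> A (vadd H x y) = vadd H (A x) (A y)"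
    and "x \<in> carrier H \<Longrightarrow> A (vscale H c x) = vscale H c (A x)"
    and "A \<in> extensional (carrier H)"
  using assms by (auto simp: bounded_ops_def PiE_def)

lemma bounded_op_bound:
  assumes "A \<in> bounded_ops H"
  obtains C where "0 \<le> C" "\<And>x. x \<in> carrier H \<Longrightarrow> vnorm H (A x) \<le> C * vnorm H x"
proof -
  obtain C where C: "\<And>x. x \<in> carrier H \<Longrightarrow> vnorm H (A x) \<le> C * vnorm H x"
    using assms unfolding bounded_ops_def by blast
  have "vnorm H (A x) \<le> \<bar>C\<bar> * vnorm H x" if "x \<in> carrier H" for x
    using C[OF that] mult_right_mono[OF abs_ge_self[of C] vnorm_nonneg[OF that]] by linarith
  thus ?thesis using that[of "\<bar>C\<bar>"] by simp
qed

lemma bounded_op_zero: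
  assumes "A \<in> bounded_ops H"
  shows "A (vzero H) = vzero H"
proof -
  have "vscale H 0 (vzero H) = vzero H"
    by (rule vinner_ext) auto
  moreover have "vscale H 0 (A (vzero H)) = vzero H"
    by (rule vinner_ext) (use bounded_opD(1)[OF assms] in auto)
  ultimately show ?thesis
    using bounded_opD(3)[OF assms, of "vzero H" 0] by simp
qed

text \<open>Operators are compared through their matrix elements, as vectors are through their inner
  products.\<close>

lemma bounded_op_eqI:
  assumes "A \<in> bounded_ops H" "B \<in> bounded_ops H"
    and "\<And>x y. x \<in> carrier H \<Longrightarrow> y \<in> carrier H \<Longrightarrow> vinner H y (A x) = vinner H y (B x)"
  shows "A = B"
proof (rule extensionalityI[where A = "carrier H"])
  show "A x = B x" if "x \<in> carrier H" for x
    by (rule vinner_ext) (use that assms bounded_opD(1) in auto)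
qed (use assms bounded_opD(4) in auto)

lemma bounded_opI:
  assumes "A \<in> extensional (carrier H)"
    and "\<And>x. x \<in> carrier H \<Longrightarrow> A x \<in> carrier H"
    and "\<And>x y z. x \<in> carrier H \<Longrightarrow> y \<in> carrier H \<Longrightarrow> z \<in> carrier H \<Longrightarrow>
      vinner H z (A (vadd H x y)) = vinner H z (A x) + vinner H z (A y)"
    and "\<And>c x z. x \<in> carrier H \<Longrightarrow> z \<in> carrier H \<Longrightarrow>
      vinner H z (A (vscale H c x)) = c * vinner H z (A x)"
    and "\<And>x. x \<in> carrier H \<Longrightarrow> vnorm H (A x) \<le> C * vnorm H x"
  shows "A \<in> bounded_ops H"
  unfolding bounded_ops_def mem_Collect_eq
proof (intro conjI ballI allI)
  show "A \<in> carrier H \<rightarrow>\<^sub>E carrier H"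
    using assms(1,2) by (auto simp: PiE_def)
  show "A (vadd H x y) = vadd H (A x) (A y)" if "x \<in> carrier H" "y \<in> carrier H" for x y
    by (rule vinner_ext) (use that assms(2,3) in auto)
  show "A (vscale H c x) = vscale H c (A x)" if "x \<in> carrier H" for c x
    by (rule vinner_ext) (use that assms(2,4) in auto)
  show "\<exists>C. \<forall>x\<in>carrier H. vnorm H (A x) \<le> C * vnorm H x"
    using assms(5) by blast
qed

lemma vadd_in_ops:
  assumes A: "A \<in> bounded_ops H" and B: "B \<in> bounded_ops H"
  shows "(\<lambda>x\<in>carrier H. vadd H (A x) (B x)) \<in> bounded_ops H"
proof -
  obtain C where C: "0 \<le> C" "\<And>x. x \<in> carrier H \<Longrightarrow> vnorm H (A x) \<le> C * vnorm H x"
    using bounded_op_bound[OF A] by blast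
  obtain D where D: "0 \<le> D" "\<And>x. x \<in> carrier H \<Longrightarrow> vnorm H (B x) \<le> D * vnorm H x"
    using bounded_op_bound[OF B] by blast
  note [simp] = bounded_opD(1-3)[OF A] bounded_opD(1-3)[OF B]
  show ?thesis
  proof (rule bounded_opI[where C = "C + D"])
    fix x assume x: "x \<in> carrier H"
    define u v where "u = A x" and "v = B x"
    have uv [simp]: "u \<in> carrier H" "v \<in> carrier H" using x by (simp_all add: u_def v_def)
    have "Re (vinner H u v) \<le> vnorm H u * vnorm H v"
      using Cauchy_Schwarz[OF uv] complex_Re_le_cmod order_trans by blast
    moreover have "Re (vinner H v u) = Re (vinner H u v)"
      using vinner_cnj[OF uv] by simp
    ultimately have "(vnorm H (vadd H u v))\<^sup>2 \<le> (vnorm H u + vnorm H v)\<^sup>2"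
      by (simp add: vnorm_sq power2_sum)
    hence "vnorm H (vadd H u v) \<le> vnorm H u + vnorm H v"
      by (rule power2_le_imp_le) (simp add: vnorm_nonneg)
    thus "vnorm H ((\<lambda>x\<in>carrier H. vadd H (A x) (B x)) x) \<le> (C + D) * vnorm H x"
      using C(2)[OF x] D(2)[OF x] x by (simp add: u_def v_def algebra_simps)
  qed (auto simp: algebra_simps)
qed

lemma vscale_in_ops:
  assumes A: "A \<in> bounded_ops H"
  shows "(\<lambda>x\<in>carrier H. vscale H c (A x)) \<in> bounded_ops H"
proof -
  obtain C where C: "0 \<le> C" "\<And>x. x \<in> carrier H \<Longrightarrow> vnorm H (A x) \<le> C * vnorm H x"
    using bounded_op_bound[OF A] by blast
  note [simp] = bounded_opD(1-3)[OF A]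
  show ?thesis
  proof (rule bounded_opI[where C = "cmod c * C"])
    fix x assume x: "x \<in> carrier H"
    thus "vnorm H ((\<lambda>x\<in>carrier H. vscale H c (A x)) x) \<le> cmod c * C * vnorm H x"
      using mult_left_mono[OF C(2), of x "cmod c"] by (simp add: vnorm_vscale mult.assoc)
  qed (auto simp: algebra_simps)
qed

lemma compose_in_ops:
  assumes A: "A \<in> bounded_ops H" and B: "B \<in> bounded_ops H"
  shows "compose (carrier H) A B \<in> bounded_ops H"
proof -
  obtain C where C: "0 \<le> C" "\<And>x. x \<in> carrier H \<Longrightarrow> vnorm H (A x) \<le> C * vnorm H x"
    using bounded_op_bound[OF A] by blast
  obtain D where D: "0 \<le> D" "\<And>x. x \<in> carrier H \<Longrightarrow> vnorm H (B x) \<le> D * vnorm H x"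
    using bounded_op_bound[OF B] by blast
  note [simp] = bounded_opD(1-3)[OF A] bounded_opD(1-3)[OF B]
  show ?thesis
  proof (rule bounded_opI[where C = "C * D"])
    fix x assume x: "x \<in> carrier H"
    have "vnorm H (A (B x)) \<le> C * vnorm H (B x)" using C(2) x by simp
    also have "\<dots> \<le> C * (D * vnorm H x)" by (intro mult_left_mono D(2) C(1) x)
    finally show "vnorm H (compose (carrier H) A B x) \<le> C * D * vnorm H x"
      using x by (simp add: compose_def)
  qed (auto simp: compose_def)
qed

lemma zero_in_ops: "(\<lambda>x\<in>carrier H. vzero H) \<in> bounded_ops H"
  by (rule bounded_opI[where C = 0]) (auto simp: vnorm_def)

section \<open>Orthonormal sets and Hilbert bases\<close>

lemma lincomb_exists:
  assumes "finite F" "F \<subseteq> carrier H"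
  shows "\<exists>s\<in>carrier H. (\<forall>z\<in>carrier H. vinner H z s = (\<Sum>e\<in>F. c e * vinner H z e)) \<and>
    (\<forall>A\<in>bounded_ops H. \<forall>z\<in>carrier H. vinner H z (A s) = (\<Sum>e\<in>F. c e * vinner H z (A e)))"
  using assms
proof (induction F rule: finite_induct)
  case empty
  show ?case
    by (rule bexI[of _ "vzero H"]) (auto simp: bounded_op_zero)
next
  case (insert e F)
  then obtain s where s: "s \<in> carrier H"
    "\<And>z. z \<in> carrier H \<Longrightarrow> vinner H z s = (\<Sum>e\<in>F. c e * vinner H z e)"
    "\<And>A z. A \<in> bounded_ops H \<Longrightarrow> z \<in> carrier H \<Longrightarrow>
       vinner H z (A s) = (\<Sum>e\<in>F. c e * vinner H z (A e))"
    by auto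
  have e: "e \<in> carrier H" using insert by auto
  show ?case
    by (rule bexI[of _ "vadd H (vscale H (c e) e) s"])
       (use insert.hyps s e in \<open>auto simp: bounded_opD\<close>)
qed

text \<open>The sum \<open>\<Sum>e\<in>F. c e * e\<close>. A bare carrier with \<open>vadd\<close> has no finite sums, so the vector is
  chosen by the two properties that characterize it: its inner products, and those of its image under
  a bounded operator.\<close>

definition lincomb :: "('h \<Rightarrow> complex) \<Rightarrow> 'h set \<Rightarrow> 'h" where
  "lincomb c F = (SOME s. s \<in> carrier H \<and>
     (\<forall>z\<in>carrier H. vinner H z s = (\<Sum>e\<in>F. c e * vinner H z e)) \<and>
     (\<forall>A\<in>bounded_ops H. \<forall>z\<in>carrier H. vinner H z (A s) = (\<Sum>e\<in>F. c e * vinner H z (A e))))"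

lemma lincomb:
  assumes "finite F" "F \<subseteq> carrier H"
  shows lincomb_closed: "lincomb c F \<in> carrier H"
    and vinner_lincomb: "z \<in> carrier H \<Longrightarrow>
      vinner H z (lincomb c F) = (\<Sum>e\<in>F. c e * vinner H z e)"
    and vinner_op_lincomb: "A \<in> bounded_ops H \<Longrightarrow> z \<in> carrier H \<Longrightarrow>
      vinner H z (A (lincomb c F)) = (\<Sum>e\<in>F. c e * vinner H z (A e))"
  using someI_ex[OF lincomb_exists[OF assms, of c, unfolded Bex_def], folded lincomb_def] by auto

definition orthonormal :: "'h set \<Rightarrow> bool" where
  "orthonormal E \<longleftrightarrow> E \<subseteq> carrier H \<and>
     (\<forall>x\<in>E. \<forall>y\<in>E. vinner H x y = (if x = y then 1 else 0))"

lemma orthonormalD: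
  assumes "orthonormal E"
  shows "x \<in> E \<Longrightarrow> x \<in> carrier H"
    and "x \<in> E \<Longrightarrow> y \<in> E \<Longrightarrow> vinner H x y = (if x = y then 1 else 0)"
  using assms by (auto simp: orthonormal_def)

lemma vinner_orthonormal_lincomb:
  assumes "orthonormal E" "finite F" "F \<subseteq> E" "e \<in> F"
  shows "vinner H e (lincomb c F) = c e"
proof -
  have "vinner H e (lincomb c F) = (\<Sum>d\<in>F. c d * vinner H e d)"
    by (rule vinner_lincomb) (use assms orthonormalD(1) in auto)
  also have "\<dots> = (\<Sum>d\<in>F. if e = d then c d else 0)"
    by (rule sum.cong[OF refl]) (use assms(3,4) in \<open>auto simp: orthonormalD(2)[OF assms(1)] subsetD\<close>)
  finally show ?thesis using assms by simp
qed

lemma vnorm_lincomb: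
  assumes "orthonormal E" "finite F" "F \<subseteq> E"
  shows "(vnorm H (lincomb c F))\<^sup>2 = (\<Sum>e\<in>F. (cmod (c e))\<^sup>2)"
proof -
  have FH: "F \<subseteq> carrier H" using assms orthonormalD(1) by blast
  note s = lincomb_closed[OF assms(2) FH, of c]
  have "vinner H (lincomb c F) (lincomb c F) = (\<Sum>e\<in>F. c e * cnj (vinner H e (lincomb c F)))"
    unfolding vinner_lincomb[OF assms(2) FH s]
    by (rule sum.cong) (use FH vinner_cnj[OF _ s] in auto)
  also have "\<dots> = (\<Sum>e\<in>F. of_real ((cmod (c e))\<^sup>2))"
    using assms by (intro sum.cong) (auto simp: vinner_orthonormal_lincomb of_real_cmod_sq)
  also have "\<dots> = of_real (\<Sum>e\<in>F. (cmod (c e))\<^sup>2)"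
    by simp
  finally show ?thesis using s by (simp add: vnorm_sq)
qed

text \<open>Pythagoras: the error of the orthogonal projection is what is missing in the square sum of the
  Fourier coefficients.\<close>

lemma vnorm_minus_projection:
  assumes "orthonormal E" "finite F" "F \<subseteq> E" and x: "x \<in> carrier H"
  shows "(vnorm H (vadd H x (vscale H (-1) (lincomb (\<lambda>e. vinner H e x) F))))\<^sup>2 =
    Re (vinner H x x) - (\<Sum>e\<in>F. (cmod (vinner H e x))\<^sup>2)"
proof -
  have FH: "F \<subseteq> carrier H" using assms orthonormalD(1) by blast
  define s where "s = lincomb (\<lambda>e. vinner H e x) F"
  have s [simp]: "s \<in> carrier H" unfolding s_def by (rule lincomb_closed[OF assms(2) FH])
  define q where "q = (\<Sum>e\<in>F. (cmod (vinner H e x))\<^sup>2)"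
  have "vinner H x s = (\<Sum>e\<in>F. vinner H e x * vinner H x e)"
    unfolding s_def by (rule vinner_lincomb[OF assms(2) FH x])
  also have "\<dots> = (\<Sum>e\<in>F. of_real ((cmod (vinner H e x))\<^sup>2))"
    by (rule sum.cong) (use FH x vinner_cnj[of _ x] in \<open>auto simp: of_real_cmod_sq\<close>)
  finally have xs: "vinner H x s = of_real q" by (simp add: q_def)
  have sx: "vinner H s x = of_real q" using vinner_cnj[OF x s] xs by simp
  have "(vnorm H s)\<^sup>2 = q"
    unfolding s_def q_def by (rule vnorm_lincomb[OF assms(1-3)])
  hence ss: "vinner H s s = of_real q"
    using vinner_self[OF s] by (simp add: vnorm_sq)
  have "vinner H (vadd H x (vscale H (-1) s)) (vadd H x (vscale H (-1) s)) =
      vinner H x x - of_real q"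
    using x by (simp add: xs sx ss)
  hence "Re (vinner H (vadd H x (vscale H (-1) s)) (vadd H x (vscale H (-1) s))) =
      Re (vinner H x x) - q"
    by (simp only: minus_complex.sel Re_complex_of_real)
  thus ?thesis using x by (simp only: vnorm_sq s s_def[symmetric] q_def[symmetric] vadd_closed vscale_closed)
qed

lemma Bessel:
  assumes "orthonormal E" "finite F" "F \<subseteq> E" "x \<in> carrier H"
  shows "(\<Sum>e\<in>F. (cmod (vinner H e x))\<^sup>2) \<le> Re (vinner H x x)"
  using vnorm_minus_projection[OF assms] zero_le_power2 by (metis diff_ge_0_iff_ge)

text \<open>Completeness enters the theory only here. Finite sets that exhaust the square sum of the
  coefficients up to \<open>(1/16) ^ n\<close> turn the family into a sequence whose steps shrink fast enough to
  have a weak limit; the tails are controlled by the same bound, which upgrades convergence along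
  the sequence to convergence along all finite subsets.\<close>

lemma Riesz_Fischer:
  assumes E: "orthonormal E"
    and bound: "\<And>F. finite F \<Longrightarrow> F \<subseteq> E \<Longrightarrow> (\<Sum>e\<in>F. (cmod (c e))\<^sup>2) \<le> B"
  obtains y where "y \<in> carrier H"
    and "\<And>z. z \<in> carrier H \<Longrightarrow> ((\<lambda>e. c e * vinner H z e) has_sum vinner H z y) E"
    and "\<And>e. e \<in> E \<Longrightarrow> vinner H e y = c e"
proof -
  define \<F> where "\<F> = {F. finite F \<and> F \<subseteq> E}"
  define q where "q F = (\<Sum>e\<in>F. (cmod (c e))\<^sup>2)" for F
  define S where "S = (SUP F\<in>\<F>. q F)"
  have bdd: "bdd_above (q ` \<F>)"
    using bound by (auto simp: bdd_above_def \<F>_def q_def)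
  have ne: "\<F> \<noteq> {}" by (auto simp: \<F>_def)
  have q_le: "q F \<le> S" if "F \<in> \<F>" for F
    unfolding S_def by (rule cSUP_upper[OF that bdd])
  have "\<exists>F\<in>\<F>. S - (1/16) ^ n < q F" for n :: nat
    unfolding S_def by (subst less_cSUP_iff[OF ne bdd, symmetric]) simp
  then obtain F' where F': "\<And>n. F' n \<in> \<F>" "\<And>n. S - (1/16) ^ n < q (F' n)"
    by metis
  define F where "F n = (\<Union>k\<le>n. F' k)" for n :: nat
  have F\<F>: "F n \<in> \<F>" for n
    using F'(1) by (auto simp: F_def \<F>_def)
  have tail: "q (G - F n) \<le> (1/16) ^ n" if "G \<in> \<F>" "F n \<subseteq> G" for G n
  proof -
    have "q (F' n) \<le> q (F n)"
      unfolding q_def by (rule sum_mono2) (use F\<F>[of n] in \<open>auto simp: \<F>_def F_def\<close>)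
    moreover have "q (G - F n) = q G - q (F n)"
      unfolding q_def by (rule sum_diff) (use that in \<open>auto simp: \<F>_def\<close>)
    ultimately show ?thesis using q_le[OF that(1)] F'(2)[of n] by linarith
  qed
  have \<F>H: "finite G" "G \<subseteq> carrier H" if "G \<in> \<F>" for G
    using that orthonormalD(1)[OF E] by (auto simp: \<F>_def)
  have diff: "vinner H z (lincomb c G) - vinner H z (lincomb c G') = vinner H z (lincomb c (G - G'))"
    if "G \<in> \<F>" "G' \<subseteq> G" "z \<in> carrier H" for G G' z
  proof -
    have "G' \<in> \<F>" "G - G' \<in> \<F>" using that by (auto simp: \<F>_def finite_subset)
    thus ?thesis using that by (simp add: vinner_lincomb \<F>H sum_diff)
  qed
  have small: "vnorm H (lincomb c (G - F n)) \<le> (1/4) ^ n" if "G \<in> \<F>" "F n \<subseteq> G" for G n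
  proof (rule power2_le_imp_le)
    have "(vnorm H (lincomb c (G - F n)))\<^sup>2 = q (G - F n)"
      unfolding q_def by (rule vnorm_lincomb[OF E]) (use that in \<open>auto simp: \<F>_def\<close>)
    also have "\<dots> \<le> ((1/4) ^ n)\<^sup>2"
      using tail[OF that] by (simp add: power_mult[symmetric] power2_eq_square flip: power_mult_distrib)
    finally show "(vnorm H (lincomb c (G - F n)))\<^sup>2 \<le> ((1/4) ^ n)\<^sup>2" .
  qed auto
  have "\<exists>y\<in>carrier H. \<forall>z\<in>carrier H. (\<lambda>n. vinner H z (lincomb c (F n))) \<longlonglongrightarrow> vinner H z y"
  proof (rule fast_cauchy_weak_limit)
    show X: "lincomb c (F n) \<in> carrier H" for n
      by (intro lincomb_closed \<F>H F\<F>)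
    fix n
    have sub: "F n \<subseteq> F (Suc n)" unfolding F_def by (rule UN_mono) auto
    have "F (Suc n) - F n \<in> \<F>" using F\<F>[of "Suc n"] by (auto simp: \<F>_def)
    note cl = lincomb_closed[OF \<F>H[OF this], of c]
    have "vadd H (lincomb c (F (Suc n))) (vscale H (-1) (lincomb c (F n))) =
        lincomb c (F (Suc n) - F n)"
      by (rule vinner_ext) (use X cl diff[OF F\<F> sub] in \<open>auto simp: algebra_simps\<close>)
    thus "vnorm H (vadd H (lincomb c (F (Suc n))) (vscale H (-1) (lincomb c (F n)))) \<le> (1/4) ^ n"
      using small[OF F\<F> sub] by simp
  qed
  then obtain y where y: "y \<in> carrier H"
    and lim: "\<And>z. z \<in> carrier H \<Longrightarrow> (\<lambda>n. vinner H z (lincomb c (F n))) \<longlonglongrightarrow> vinner H z y"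
    by blast
  have sums: "((\<lambda>e. c e * vinner H z e) has_sum vinner H z y) E" if z: "z \<in> carrier H" for z
    unfolding has_sum_def
  proof (rule tendstoI)
    fix \<epsilon> :: real assume \<epsilon>: "0 < \<epsilon>"
    have "(\<lambda>n. vnorm H z * (1/4) ^ n) \<longlonglongrightarrow> vnorm H z * 0"
      by (intro tendsto_mult tendsto_const LIMSEQ_power_zero) simp
    hence "\<forall>\<^sub>F n in sequentially. vnorm H z * (1/4) ^ n < \<epsilon> / 2"
      by (rule order_tendstoD) (use \<epsilon> in simp)
    moreover have "\<forall>\<^sub>F n in sequentially. dist (vinner H z (lincomb c (F n))) (vinner H z y) < \<epsilon> / 2"
      using lim[OF z] \<epsilon> by (intro tendstoD) auto
    ultimately have "\<forall>\<^sub>F n in sequentially. vnorm H z * (1/4) ^ n < \<epsilon> / 2 \<and>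
        dist (vinner H z (lincomb c (F n))) (vinner H z y) < \<epsilon> / 2"
      by (rule eventually_conj)
    then obtain n where n: "vnorm H z * (1/4) ^ n < \<epsilon> / 2"
      "dist (vinner H z (lincomb c (F n))) (vinner H z y) < \<epsilon> / 2"
      unfolding eventually_sequentially by blast
    show "\<forall>\<^sub>F G in finite_subsets_at_top E. dist (\<Sum>e\<in>G. c e * vinner H z e) (vinner H z y) < \<epsilon>"
      unfolding eventually_finite_subsets_at_top
    proof (intro exI[of _ "F n"] conjI allI impI)
      show "finite (F n)" "F n \<subseteq> E" using F\<F>[of n] by (auto simp: \<F>_def)
      fix G assume "finite G \<and> F n \<subseteq> G \<and> G \<subseteq> E"
      hence G: "G \<in> \<F>" and sub: "F n \<subseteq> G" by (auto simp: \<F>_def)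
      have "G - F n \<in> \<F>" using G by (auto simp: \<F>_def)
      note cl = lincomb_closed[OF \<F>H[OF this], of c]
      have "(\<Sum>e\<in>G. c e * vinner H z e) = vinner H z (lincomb c G)"
        using vinner_lincomb[OF \<F>H[OF G] z] by simp
      also have "\<dots> = vinner H z (lincomb c (F n)) + vinner H z (lincomb c (G - F n))"
        unfolding diff[OF G sub z, symmetric] by simp
      finally have "dist (\<Sum>e\<in>G. c e * vinner H z e) (vinner H z y) \<le>
          dist (vinner H z (lincomb c (F n))) (vinner H z y) + cmod (vinner H z (lincomb c (G - F n)))"
        using norm_triangle_ineq[of "vinner H z (lincomb c (F n)) - vinner H z y"
            "vinner H z (lincomb c (G - F n))"]
        by (simp add: dist_norm algebra_simps)
      moreover have "cmod (vinner H z (lincomb c (G - F n))) \<le> vnorm H z * (1/4) ^ n"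
        using Cauchy_Schwarz[OF z cl] mult_left_mono[OF small[OF G sub] vnorm_nonneg[OF z]]
        by linarith
      ultimately show "dist (\<Sum>e\<in>G. c e * vinner H z e) (vinner H z y) < \<epsilon>"
        using n by linarith
    qed
  qed
  have "vinner H e y = c e" if e: "e \<in> E" for e
  proof -
    have "((\<lambda>d. c d * vinner H e d) has_sum (\<Sum>d\<in>{e}. c d * vinner H e d)) {e}"
      by (rule has_sum_finite) simp
    hence "((\<lambda>d. c d * vinner H e d) has_sum c e) {e}"
      using e orthonormalD[OF E] by simp
    moreover have "((\<lambda>d. c d * vinner H e d) has_sum c e) {e} \<longleftrightarrow>
        ((\<lambda>d. c d * vinner H e d) has_sum c e) E"
      by (rule has_sum_cong_neutral) (use e orthonormalD[OF E] in auto)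
    ultimately show ?thesis
      using sums[OF orthonormalD(1)[OF E e]] has_sum_unique by blast
  qed
  with y sums show ?thesis using that by blast
qed

lemma hilbert_basis_orthonormal: "hilbert_basis H E \<Longrightarrow> orthonormal E"
  by (simp add: hilbert_basis_def orthonormal_def)

text \<open>The Riesz-Fischer vector \<open>y\<close> with the coefficients of \<open>w\<close> differs from \<open>w\<close> by a vector
  orthogonal to the basis, hence equals \<open>w\<close>.\<close>

lemma Parseval:
  assumes E: "hilbert_basis H E" and v: "v \<in> carrier H" and w: "w \<in> carrier H"
  shows "((\<lambda>e. vinner H e w * vinner H v e) has_sum vinner H v w) E"
proof -
  note on = hilbert_basis_orthonormal[OF E]
  obtain y where y: "y \<in> carrier H"
    and sums: "\<And>z. z \<in> carrier H \<Longrightarrow> ((\<lambda>e. vinner H e w * vinner H z e) has_sum vinner H z y) E"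
    and coeff: "\<And>e. e \<in> E \<Longrightarrow> vinner H e y = vinner H e w"
    using Riesz_Fischer[OF on Bessel[OF on _ _ w]] by metis
  have "vadd H w (vscale H (-1) y) = vzero H"
    using E y w coeff orthonormalD(1)[OF on] by (auto simp: hilbert_basis_def)
  hence "w = y" by (rule vadd_diff_zeroD[OF w y])
  thus ?thesis using sums[OF v] by simp
qed

text \<open>A maximal orthonormal set is a basis: a nonzero vector orthogonal to it could be normalized
  and added.\<close>

lemma hilbert_basis_exists: "\<exists>E. hilbert_basis H E"
proof -
  have "\<exists>M\<in>Collect orthonormal. \<forall>X\<in>Collect orthonormal. M \<subseteq> X \<longrightarrow> X = M"
  proof (rule subset_Zorn')
    fix C assume "subset.chain (Collect orthonormal) C"
    hence C: "\<And>E. E \<in> C \<Longrightarrow> orthonormal E" "\<And>E F. E \<in> C \<Longrightarrow> F \<in> C \<Longrightarrow> E \<subseteq> F \<or> F \<subseteq> E"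
      by (auto simp: subset.chain_def)
    have "vinner H x y = (if x = y then 1 else 0)" if "x \<in> E" "E \<in> C" "y \<in> F" "F \<in> C" for x y E F
      using C(2)[OF that(2,4)] that C(1) orthonormalD(2) by blast
    hence "orthonormal (\<Union>C)"
      unfolding orthonormal_def using orthonormalD(1)[OF C(1)] by blast
    thus "\<Union>C \<in> Collect orthonormal" by simp
  qed
  then obtain E where "E \<in> Collect orthonormal"
    and max': "\<forall>X\<in>Collect orthonormal. E \<subseteq> X \<longrightarrow> X = E" ..
  hence E: "orthonormal E" by simp
  have max: "X = E" if "orthonormal X" "E \<subseteq> X" for X
    using bspec[OF max', of X] that by simp
  have "x = vzero H" if x: "x \<in> carrier H" and orth: "\<forall>y\<in>E. vinner H y x = 0" for x
  proof (rule ccontr)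
    assume "x \<noteq> vzero H"
    with vinner_definite[OF x] have "vinner H x x \<noteq> 0" by blast
    hence pos: "vnorm H x \<noteq> 0" using vinner_self[OF x] vnorm_sq[OF x] by auto
    define u where "u = vscale H (1 / of_real (vnorm H x)) x"
    have u: "u \<in> carrier H" using x by (simp add: u_def)
    have "vinner H x x = of_real (vnorm H x) * of_real (vnorm H x)"
      using vinner_self[OF x] vnorm_sq[OF x] by (simp add: power2_eq_square flip: of_real_mult)
    hence uu: "vinner H u u = 1"
      using x pos by (simp add: u_def)
    have eu: "vinner H e u = 0" "vinner H u e = 0" if "e \<in> E" for e
      using that orth x orthonormalD(1)[OF E that] vinner_cnj[of e x] by (auto simp: u_def)
    have "u \<notin> E" using eu(1)[of u] uu by auto
    moreover have "orthonormal (insert u E)"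
      unfolding orthonormal_def
    proof (intro conjI ballI)
      show "insert u E \<subseteq> carrier H" using u orthonormalD(1)[OF E] by auto
      fix x y assume "x \<in> insert u E" "y \<in> insert u E"
      thus "vinner H x y = (if x = y then 1 else 0)"
        using uu eu orthonormalD(2)[OF E] \<open>u \<notin> E\<close> by (cases "x = u"; cases "y = u") simp_all
    qed
    hence "insert u E = E" by (rule max) blast
    ultimately show False by blast
  qed
  hence "hilbert_basis H E"
    unfolding hilbert_basis_def using E[unfolded orthonormal_def] by simp
  thus ?thesis ..
qed

section \<open>Adjoints\<close>

text \<open>Riesz representation of the functional \<open>z \<mapsto> \<langle>x, A z\<rangle>\<close>. Its values on a basis are square summable
  because \<open>A\<close> is bounded, so they are the coefficients of some \<open>y\<close>; the two functionals agree on the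
  basis, and therefore everywhere since partial sums of the Fourier expansion of \<open>z\<close> converge in
  norm.\<close>

lemma adjoint_vector_exists:
  assumes A: "A \<in> bounded_ops H" and x: "x \<in> carrier H"
  shows "\<exists>y\<in>carrier H. \<forall>z\<in>carrier H. vinner H y z = vinner H x (A z)"
proof -
  obtain E where E: "hilbert_basis H E" using hilbert_basis_exists by blast
  note on = hilbert_basis_orthonormal[OF E]
  obtain C where C: "0 \<le> C" "\<And>x. x \<in> carrier H \<Longrightarrow> vnorm H (A x) \<le> C * vnorm H x"
    using bounded_op_bound[OF A] by blast
  note Acl = bounded_opD(1)[OF A]
  have bound: "(\<Sum>e\<in>F. (cmod (vinner H (A e) x))\<^sup>2) \<le> (C * vnorm H x)\<^sup>2"
    if F: "finite F" "F \<subseteq> E" for F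
  proof -
    have FH: "F \<subseteq> carrier H" using F orthonormalD(1)[OF on] by blast
    define s where "s = lincomb (\<lambda>e. vinner H (A e) x) F"
    define q where "q = (\<Sum>e\<in>F. (cmod (vinner H (A e) x))\<^sup>2)"
    have s: "s \<in> carrier H" unfolding s_def by (rule lincomb_closed[OF F(1) FH])
    have qs: "(vnorm H s)\<^sup>2 = q" unfolding s_def q_def by (rule vnorm_lincomb[OF on F])
    have "vinner H x (A s) = (\<Sum>e\<in>F. vinner H (A e) x * vinner H x (A e))"
      unfolding s_def by (rule vinner_op_lincomb[OF F(1) FH A x])
    also have "\<dots> = (\<Sum>e\<in>F. of_real ((cmod (vinner H (A e) x))\<^sup>2))"
      by (rule sum.cong) (use FH x Acl vinner_cnj[OF _ x] in \<open>auto simp: of_real_cmod_sq\<close>)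
    finally have "vinner H x (A s) = of_real q" by (simp add: q_def)
    hence "\<bar>q\<bar> \<le> vnorm H x * vnorm H (A s)"
      using Cauchy_Schwarz[OF x Acl[OF s]] by simp
    also have "\<dots> \<le> vnorm H x * (C * vnorm H s)"
      by (intro mult_left_mono C s vnorm_nonneg x)
    finally have "vnorm H s * vnorm H s \<le> (C * vnorm H x) * vnorm H s"
      by (simp add: qs[symmetric] power2_eq_square mult_ac)
    hence "vnorm H s \<le> C * vnorm H x"
      using vnorm_nonneg[OF s] vnorm_nonneg[OF x] C(1)
      by (cases "vnorm H s = 0") (auto simp: mult_le_cancel_right)
    thus ?thesis
      using power_mono[OF _ vnorm_nonneg[OF s]] qs by (fastforce simp: q_def)
  qed
  obtain y where y: "y \<in> carrier H"
    and sums: "\<And>z. z \<in> carrier H \<Longrightarrow> ((\<lambda>e. vinner H (A e) x * vinner H z e) has_sum vinner H z y) E"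
    using Riesz_Fischer[OF on bound] by metis
  have "vinner H y z = vinner H x (A z)" if z: "z \<in> carrier H" for z
  proof -
    have "((\<lambda>e. cnj (vinner H (A e) x * vinner H z e)) has_sum cnj (vinner H z y)) E"
      using sums[OF z] by (rule has_sum_bounded_linear[OF bounded_linear_cnj])
    moreover have "((\<lambda>e. cnj (vinner H (A e) x * vinner H z e)) has_sum cnj (vinner H z y)) E \<longleftrightarrow>
        ((\<lambda>e. vinner H e z * vinner H x (A e)) has_sum cnj (vinner H z y)) E"
      by (rule has_sum_cong)
         (use vinner_cnj[OF z] vinner_cnj[OF _ x] Acl orthonormalD(1)[OF on] in auto)
    ultimately have "((\<lambda>e. vinner H e z * vinner H x (A e)) has_sum vinner H y z) E"
      using vinner_cnj[OF z y] by simp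
    moreover have "((\<lambda>e. vinner H e z * vinner H x (A e)) has_sum vinner H x (A z)) E"
      unfolding has_sum_def
    proof (rule Lim_null[THEN iffD2], rule Lim_null_comparison)
      define r where "r F = Re (vinner H z z) - (\<Sum>e\<in>F. (cmod (vinner H e z))\<^sup>2)" for F
      have "((\<lambda>e. of_real ((cmod (vinner H e z))\<^sup>2)) has_sum complex_of_real (Re (vinner H z z))) E"
        unfolding vinner_self[OF z, symmetric]
      proof (rule has_sum_cong[THEN iffD1, OF _ Parseval[OF E z z]])
        show "vinner H e z * vinner H z e = of_real ((cmod (vinner H e z))\<^sup>2)" if "e \<in> E" for e
          using z vinner_cnj[of e z] orthonormalD(1)[OF on that] by (simp add: of_real_cmod_sq)
      qed
      hence "((\<lambda>e. (cmod (vinner H e z))\<^sup>2) has_sum Re (vinner H z z)) E"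
        by (simp only: has_sum_of_real_iff)
      hence "(r \<longlongrightarrow> Re (vinner H z z) - Re (vinner H z z)) (finite_subsets_at_top E)"
        unfolding r_def has_sum_def by (intro tendsto_diff tendsto_const)
      hence "((\<lambda>F. vnorm H x * (C * sqrt (r F))) \<longlongrightarrow> vnorm H x * (C * sqrt 0)) (finite_subsets_at_top E)"
        by (intro tendsto_intros) simp
      thus "((\<lambda>F. vnorm H x * (C * sqrt (r F))) \<longlongrightarrow> 0) (finite_subsets_at_top E)" by simp
      show "\<forall>\<^sub>F F in finite_subsets_at_top E.
          cmod ((\<Sum>e\<in>F. vinner H e z * vinner H x (A e)) - vinner H x (A z))
            \<le> vnorm H x * (C * sqrt (r F))"
      proof (rule eventually_finite_subsets_at_top_weakI)
        fix F assume F: "finite F" "F \<subseteq> E"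
        have FH: "F \<subseteq> carrier H" using F orthonormalD(1)[OF on] by blast
        define s where "s = lincomb (\<lambda>e. vinner H e z) F"
        have s: "s \<in> carrier H" unfolding s_def by (rule lincomb_closed[OF F(1) FH])
        define d where "d = vadd H z (vscale H (-1) s)"
        have d: "d \<in> carrier H" using s z by (simp add: d_def)
        have "vinner H x (A d) = vinner H x (A z) - vinner H x (A s)"
          using s z x Acl by (simp add: d_def bounded_opD(2,3)[OF A])
        moreover have "vinner H x (A s) = (\<Sum>e\<in>F. vinner H e z * vinner H x (A e))"
          unfolding s_def by (rule vinner_op_lincomb[OF F(1) FH A x])
        ultimately have "cmod ((\<Sum>e\<in>F. vinner H e z * vinner H x (A e)) - vinner H x (A z)) =
            cmod (vinner H x (A d))"
          by (simp add: norm_minus_commute)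
        also have "\<dots> \<le> vnorm H x * vnorm H (A d)" by (rule Cauchy_Schwarz[OF x Acl[OF d]])
        also have "\<dots> \<le> vnorm H x * (C * vnorm H d)"
          by (intro mult_left_mono C d vnorm_nonneg x)
        also have "vnorm H d = sqrt (r F)"
          using vnorm_minus_projection[OF on F z] vnorm_nonneg[OF d]
          by (simp add: r_def d_def s_def real_sqrt_unique)
        finally show "cmod ((\<Sum>e\<in>F. vinner H e z * vinner H x (A e)) - vinner H x (A z))
            \<le> vnorm H x * (C * sqrt (r F))" .
      qed
    qed
    ultimately show ?thesis using has_sum_unique by blast
  qed
  with y show ?thesis by blast
qed

lemma op_adjoint_eqI:
  assumes B: "B \<in> bounded_ops H"
    and adj: "\<And>x y. x \<in> carrier H \<Longrightarrow> y \<in> carrier H \<Longrightarrow> vinner H (B x) y = vinner H x (A y)"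
  shows "op_adjoint H A = B"
  unfolding op_adjoint_def
proof (rule the_equality)
  show "B \<in> bounded_ops H \<and> (\<forall>x\<in>carrier H. \<forall>y\<in>carrier H. vinner H (B x) y = vinner H x (A y))"
    using assms by blast
  fix B' assume B': "B' \<in> bounded_ops H \<and>
    (\<forall>x\<in>carrier H. \<forall>y\<in>carrier H. vinner H (B' x) y = vinner H x (A y))"
  show "B' = B"
  proof (rule bounded_op_eqI)
    fix x y assume xy: "x \<in> carrier H" "y \<in> carrier H"
    hence "vinner H (B' x) y = vinner H (B x) y" using B' adj by simp
    thus "vinner H y (B' x) = vinner H y (B x)"
      using xy B B' bounded_opD(1) vinner_cnj[of "B' x" y] vinner_cnj[of "B x" y] by simp
  qed (use B B' in auto)
qed

lemma op_adjoint:
  assumes A: "A \<in> bounded_ops H"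
  shows op_adjoint_in_ops: "op_adjoint H A \<in> bounded_ops H"
    and vinner_op_adjoint: "x \<in> carrier H \<Longrightarrow> y \<in> carrier H \<Longrightarrow>
      vinner H (op_adjoint H A x) y = vinner H x (A y)"
proof -
  obtain C where C: "0 \<le> C" "\<And>x. x \<in> carrier H \<Longrightarrow> vnorm H (A x) \<le> C * vnorm H x"
    using bounded_op_bound[OF A] by blast
  note Acl = bounded_opD(1)[OF A]
  define B where "B = (\<lambda>x\<in>carrier H. SOME y. y \<in> carrier H \<and>
    (\<forall>z\<in>carrier H. vinner H y z = vinner H x (A z)))"
  have B: "B x \<in> carrier H \<and> (\<forall>z\<in>carrier H. vinner H (B x) z = vinner H x (A z))"
    if "x \<in> carrier H" for x
    using someI_ex[OF adjoint_vector_exists[OF A that, unfolded Bex_def]] that by (simp add: B_def)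
  have B': "vinner H z (B x) = vinner H (A z) x" if "x \<in> carrier H" "z \<in> carrier H" for x z
    using that B[OF that(1)] Acl vinner_cnj[of "B x" z] vinner_cnj[of x "A z"] by simp
  have ext: "B \<in> extensional (carrier H)" by (simp add: B_def)
  have "B \<in> bounded_ops H"
  proof (rule bounded_opI[where C = C])
    fix x assume x: "x \<in> carrier H"
    hence b: "B x \<in> carrier H" using B by blast
    have "vinner H (B x) (B x) = vinner H x (A (B x))" using B[OF x] b by blast
    hence "cmod (vinner H (B x) (B x)) \<le> vnorm H x * vnorm H (A (B x))"
      using Cauchy_Schwarz[OF x Acl[OF b]] by simp
    also have "\<dots> \<le> vnorm H x * (C * vnorm H (B x))"
      by (intro mult_left_mono C b vnorm_nonneg x)
    finally have "(vnorm H (B x))\<^sup>2 \<le> vnorm H x * (C * vnorm H (B x))"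
      using complex_Re_le_cmod[of "vinner H (B x) (B x)"] by (simp add: vnorm_sq b)
    hence "vnorm H (B x) * vnorm H (B x) \<le> (C * vnorm H x) * vnorm H (B x)"
      by (simp add: power2_eq_square mult_ac)
    thus "vnorm H (B x) \<le> C * vnorm H x"
      using vnorm_nonneg[OF b] vnorm_nonneg[OF x] C(1)
      by (cases "vnorm H (B x) = 0") (auto simp: mult_le_cancel_right)
  qed (use ext B B' Acl in auto)
  moreover from this have "op_adjoint H A = B"
    by (rule op_adjoint_eqI) (use B in blast)
  ultimately show "op_adjoint H A \<in> bounded_ops H"
    and "x \<in> carrier H \<Longrightarrow> y \<in> carrier H \<Longrightarrow> vinner H (op_adjoint H A x) y = vinner H x (A y)"
    using B by auto
qed

section \<open>The star ring of bounded operators\<close>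

lemma op_algebra_simps [simp]:
  "carrier (op_algebra H) = bounded_ops H"
  "monoid.mult (op_algebra H) = compose (carrier H)"
  "one (op_algebra H) = (\<lambda>x\<in>carrier H. x)"
  "zero (op_algebra H) = (\<lambda>x\<in>carrier H. vzero H)"
  "add (op_algebra H) = (\<lambda>A B. \<lambda>x\<in>carrier H. vadd H (A x) (B x))"
  "star (op_algebra H) = op_adjoint H"
  "densities (op_algebra H) =
    {\<rho> \<in> trace_class H. \<rho> \<in> positives (op_star_ring H) \<and> op_trace H \<rho> = 1}"
  "pairing (op_algebra H) = (\<lambda>\<rho> A. op_trace H (compose (carrier H) \<rho> A))"
  "lact (op_algebra H) = compose (carrier H)"
  "ract (op_algebra H) = compose (carrier H)"
  "pscale (op_algebra H) = (\<lambda>c A. \<lambda>x\<in>carrier H. vscale H c (A x))"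
  by (simp_all add: op_algebra_def op_star_ring_def star_ring.extend_def vn_algebra.fields_def)

lemma op_star_ring_simps [simp]:
  "carrier (op_star_ring H) = bounded_ops H"
  "monoid.mult (op_star_ring H) = compose (carrier H)"
  "star (op_star_ring H) = op_adjoint H"
  by (simp_all add: op_star_ring_def)

lemma positives_op_algebra: "positives (op_algebra H) = positives (op_star_ring H)"
  by (simp add: positives_def)

lemma pos_sqrt_op_algebra: "pos_sqrt (op_algebra H) = pos_sqrt (op_star_ring H)"
  by (simp add: pos_sqrt_def positives_op_algebra fun_eq_iff)

lemma op_algebra_minus:
  assumes A: "A \<in> bounded_ops H" and B: "B \<in> bounded_ops H"
  shows "A \<ominus>\<^bsub>op_algebra H\<^esub> B = (\<lambda>x\<in>carrier H. vadd H (A x) (vscale H (-1) (B x)))"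
proof -
  define N where "N = (\<lambda>x\<in>carrier H. vscale H (-1) (B x))"
  note [simp] = bounded_opD(1)[OF A] bounded_opD(1)[OF B]
  have N: "N \<in> bounded_ops H" unfolding N_def by (rule vscale_in_ops[OF B])
  have "a_inv (op_algebra H) B = N"
    unfolding a_inv_def m_inv_def
  proof (rule the_equality, goal_cases)
    case 1
    have "(\<lambda>x\<in>carrier H. vadd H (B x) (N x)) = (\<lambda>x\<in>carrier H. vzero H)"
      "(\<lambda>x\<in>carrier H. vadd H (N x) (B x)) = (\<lambda>x\<in>carrier H. vzero H)"
      by (rule bounded_op_eqI, (intro vadd_in_ops zero_in_ops N B)+, simp add: N_def)+
    thus ?case using N by simp
  next
    case (2 C)
    hence C: "C \<in> bounded_ops H"
      and eq: "(\<lambda>x\<in>carrier H. vadd H (B x) (C x)) = (\<lambda>x\<in>carrier H. vzero H)" by auto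
    show ?case
    proof (rule bounded_op_eqI[OF C N])
      fix x y assume xy: "x \<in> carrier H" "y \<in> carrier H"
      have "vadd H (B x) (C x) = vzero H" using fun_cong[OF eq, of x] xy by simp
      hence "vinner H y (vadd H (B x) (C x)) = 0" using xy by simp
      thus "vinner H y (C x) = vinner H y (N x)"
        using xy bounded_opD(1)[OF C] by (simp add: N_def add_eq_0_iff)
    qed
  qed
  thus ?thesis by (auto simp: a_minus_def N_def restrict_def fun_eq_iff)
qed

lemma positive_opE:
  assumes "T \<in> positives (op_star_ring H)"
  obtains b where "b \<in> bounded_ops H" "T \<in> bounded_ops H"
    and "\<And>x y. x \<in> carrier H \<Longrightarrow> y \<in> carrier H \<Longrightarrow> vinner H x (T y) = vinner H (b x) (b y)"
proof -
  obtain b where b: "b \<in> bounded_ops H" and T: "T = compose (carrier H) (op_adjoint H b) b"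
    using assms by (auto simp: positives_def)
  have "vinner H x (T y) = vinner H (b x) (b y)" if "x \<in> carrier H" "y \<in> carrier H" for x y
    using that b bounded_opD(1)[OF b] bounded_opD(1)[OF op_adjoint_in_ops[OF b]]
      vinner_op_adjoint[OF b, of "b y" x] vinner_cnj[of "op_adjoint H b (b y)" x]
      vinner_cnj[of "b y" "b x"]
    by (simp add: T compose_def)
  moreover have "T \<in> bounded_ops H"
    unfolding T by (rule compose_in_ops[OF op_adjoint_in_ops[OF b] b])
  ultimately show ?thesis using b that by blast
qed

lemma positiveI:
  assumes "b \<in> bounded_ops H" "T \<in> bounded_ops H"
    and "\<And>x y. x \<in> carrier H \<Longrightarrow> y \<in> carrier H \<Longrightarrow> vinner H x (T y) = vinner H (b x) (b y)"
  shows "T \<in> positives (op_star_ring H)"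
proof -
  have "T = compose (carrier H) (op_adjoint H b) b"
  proof (rule bounded_op_eqI)
    fix x y assume xy: "x \<in> carrier H" "y \<in> carrier H"
    show "vinner H y (T x) = vinner H y (compose (carrier H) (op_adjoint H b) b x)"
      using xy assms bounded_opD(1)[OF assms(1)] bounded_opD(1)[OF op_adjoint_in_ops[OF assms(1)]]
        vinner_op_adjoint[OF assms(1), of "b x" y] vinner_cnj[of "op_adjoint H b (b x)" y]
        vinner_cnj[of "b x" "b y"]
      by (simp add: compose_def)
  qed (use assms op_adjoint_in_ops compose_in_ops in auto)
  thus ?thesis using assms(1) by (auto simp: positives_def)
qed

text \<open>For commuting \<open>S\<close> and \<open>T\<close> with \<open>S\<^sup>2 = T\<^sup>2\<close> one has \<open>(S + T) (S - T) = 0\<close>. Positivity of both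
  summands then forces \<open>S\<close> and \<open>T\<close> to annihilate the range of \<open>S - T\<close> separately, so that
  \<open>(S - T)\<^sup>2 = 0\<close> and \<open>S = T\<close> by self-adjointness.\<close>

lemma commuting_positive_roots_eq:
  assumes S: "S \<in> positives (op_star_ring H)" and T: "T \<in> positives (op_star_ring H)"
    and sq: "compose (carrier H) S S = compose (carrier H) T T"
    and comm: "compose (carrier H) T S = compose (carrier H) S T"
  shows "S = T"
proof -
  obtain b where b: "b \<in> bounded_ops H" and So: "S \<in> bounded_ops H"
    and Sb: "\<And>x y. x \<in> carrier H \<Longrightarrow> y \<in> carrier H \<Longrightarrow> vinner H x (S y) = vinner H (b x) (b y)"
    using positive_opE[OF S] by blast
  obtain c where c: "c \<in> bounded_ops H" and To: "T \<in> bounded_ops H"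
    and Tc: "\<And>x y. x \<in> carrier H \<Longrightarrow> y \<in> carrier H \<Longrightarrow> vinner H x (T y) = vinner H (c x) (c y)"
    using positive_opE[OF T] by blast
  note [simp] = bounded_opD(1-3)[OF b] bounded_opD(1-3)[OF c] bounded_opD(1-3)[OF So]
    bounded_opD(1-3)[OF To]
  have sa: "vinner H (S x) y = vinner H x (S y)" "vinner H (T x) y = vinner H x (T y)"
    if "x \<in> carrier H" "y \<in> carrier H" for x y
    using that Sb Tc vinner_cnj[of y "S x"] vinner_cnj[of y "T x"] vinner_cnj[of "b y" "b x"]
      vinner_cnj[of "c y" "c x"] by simp_all
  have "S x = T x" if x: "x \<in> carrier H" for x
  proof -
    have eqs: "S (S x) = T (T x)" "T (S x) = S (T x)"
      using fun_cong[OF sq, of x] fun_cong[OF comm, of x] x by (simp_all add: compose_def)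
    define y where "y = vadd H (S x) (vscale H (-1) (T x))"
    have y: "y \<in> carrier H" using x by (simp add: y_def)
    have "vinner H y (S y) + vinner H y (T y) = 0"
      using y x eqs by (simp add: y_def algebra_simps)
    hence "vinner H (b y) (b y) + vinner H (c y) (c y) = 0"
      using y Sb Tc by simp
    hence "Re (vinner H (b y) (b y)) + Re (vinner H (c y) (c y)) = 0"
      by (simp add: complex_eq_iff)
    hence "Re (vinner H (b y) (b y)) = 0" "Re (vinner H (c y) (c y)) = 0"
      using y vinner_nonneg[of "b y"] vinner_nonneg[of "c y"] by simp_all
    hence "b y = vzero H" "c y = vzero H"
      using y vinner_self[of "b y"] vinner_self[of "c y"]
        vinner_definite[of "b y"] vinner_definite[of "c y"] by simp_all
    hence "vinner H x (S y) = 0" "vinner H x (T y) = 0"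
      using x y Sb Tc by simp_all
    hence "vinner H (S x) y = 0" "vinner H (T x) y = 0"
      using sa x y by simp_all
    hence "vinner H y y = 0"
      using x y by (subst (1) y_def) simp
    hence "y = vzero H" using vinner_definite[OF y] by blast
    thus ?thesis using vadd_diff_zeroD[of "S x" "T x"] x by (simp add: y_def)
  qed
  thus ?thesis
    by (rule extensionalityI[OF bounded_opD(4)[OF So] bounded_opD(4)[OF To]])
qed

lemma pos_sqrt_eqI:
  assumes S: "S \<in> positives (op_star_ring H)" and a: "compose (carrier H) S S = a"
    and comm: "\<And>T. T \<in> positives (op_star_ring H) \<Longrightarrow> compose (carrier H) T T = a \<Longrightarrow>
      compose (carrier H) T S = compose (carrier H) S T"
  shows "pos_sqrt (op_star_ring H) a = S"
  unfolding pos_sqrt_def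
proof (rule the_equality)
  show "S \<in> positives (op_star_ring H) \<and> S \<otimes>\<^bsub>op_star_ring H\<^esub> S = a"
    using S a by simp
  fix T assume "T \<in> positives (op_star_ring H) \<and> T \<otimes>\<^bsub>op_star_ring H\<^esub> T = a"
  hence T: "T \<in> positives (op_star_ring H)" "compose (carrier H) T T = a" by simp_all
  show "T = S"
    using commuting_positive_roots_eq[OF S T(1)] comm[OF T] T(2) a by simp
qed

section \<open>Rank-one operators, traces and densities\<close>

definition ketbra :: "'h \<Rightarrow> 'h \<Rightarrow> 'h \<Rightarrow> 'h" where
  "ketbra u v = (\<lambda>x\<in>carrier H. vscale H (vinner H v x) u)"

lemma rank_one_eq_ketbra: "rank_one H \<xi> = ketbra \<xi> \<xi>"
  by (simp add: rank_one_def ketbra_def)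

lemma ketbra_in_ops:
  assumes [simp]: "u \<in> carrier H" "v \<in> carrier H"
  shows "ketbra u v \<in> bounded_ops H"
proof (rule bounded_opI[where C = "vnorm H v * vnorm H u"])
  fix x assume x: "x \<in> carrier H"
  have "vnorm H (ketbra u v x) = cmod (vinner H v x) * vnorm H u"
    using x by (simp add: ketbra_def vnorm_vscale)
  thus "vnorm H (ketbra u v x) \<le> vnorm H v * vnorm H u * vnorm H x"
    using mult_right_mono[OF Cauchy_Schwarz[of v x] vnorm_nonneg[of u]] x by (simp add: mult_ac)
qed (auto simp: ketbra_def algebra_simps)

text \<open>The trace is a Parseval sum, whatever basis the definition of \<open>op_trace\<close> selects.\<close>

lemma op_trace_ketbra:
  assumes "u \<in> carrier H" "v \<in> carrier H"
  shows "op_trace H (ketbra u v) = vinner H v u"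
proof -
  define E where "E = (SOME E. hilbert_basis H E)"
  have E: "hilbert_basis H E"
    unfolding E_def using hilbert_basis_exists by (rule someI_ex)
  have "(\<Sum>\<^sub>\<infinity>x\<in>E. vinner H x (ketbra u v x)) = (\<Sum>\<^sub>\<infinity>x\<in>E. vinner H x u * vinner H v x)"
    by (rule infsum_cong)
       (use assms orthonormalD(1)[OF hilbert_basis_orthonormal[OF E]] in \<open>simp add: ketbra_def\<close>)
  also have "\<dots> = vinner H v u"
    by (rule infsumI[OF Parseval[OF E assms(2,1)]])
  finally show ?thesis by (simp add: op_trace_def E_def)
qed

lemma compose_ketbra:
  assumes "A \<in> bounded_ops H" "u \<in> carrier H" "v \<in> carrier H"
  shows "compose (carrier H) A (ketbra u v) = ketbra (A u) v"
  using assms by (auto simp: compose_def ketbra_def bounded_opD(3) fun_eq_iff restrict_def)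

lemma ketbra_compose:
  assumes "A \<in> bounded_ops H" "v \<in> carrier H" "v' \<in> carrier H"
    and "\<And>x. x \<in> carrier H \<Longrightarrow> vinner H v (A x) = vinner H v' x"
  shows "compose (carrier H) (ketbra u v) A = ketbra u v'"
  using assms by (auto simp: compose_def ketbra_def bounded_opD(1) fun_eq_iff restrict_def)

text \<open>A density operator is determined by its state because testing against \<open>ketbra u v\<close> reads off
  its matrix elements.\<close>

lemma induced_state_inj:
  assumes \<rho>: "\<rho> \<in> bounded_ops H" and \<sigma>: "\<sigma> \<in> bounded_ops H"
    and eq: "induced_state (op_algebra H) \<rho> = induced_state (op_algebra H) \<sigma>"
  shows "\<rho> = \<sigma>"
proof (rule bounded_op_eqI[OF \<rho> \<sigma>])
  fix u v assume uv: "u \<in> carrier H" "v \<in> carrier H"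
  have "op_trace H (compose (carrier H) \<rho> (ketbra u v)) =
      op_trace H (compose (carrier H) \<sigma> (ketbra u v))"
    using fun_cong[OF eq, of "ketbra u v"] ketbra_in_ops[OF uv] by (simp add: induced_state_def)
  thus "vinner H v (\<rho> u) = vinner H v (\<sigma> u)"
    using uv by (simp add: compose_ketbra op_trace_ketbra \<rho> \<sigma> bounded_opD(1))
qed

lemma density_in_ops: "\<rho> \<in> densities (op_algebra H) \<Longrightarrow> \<rho> \<in> bounded_ops H"
  by (simp add: trace_class_def)

lemma density_of_op_algebra:
  assumes "\<rho> \<in> densities (op_algebra H)"
  shows "density_of (op_algebra H) (induced_state (op_algebra H) \<rho>) = \<rho>"
  unfolding density_of_def
proof (rule the_equality)
  fix \<sigma> assume "\<sigma> \<in> densities (op_algebra H) \<and>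
    induced_state (op_algebra H) \<sigma> = induced_state (op_algebra H) \<rho>"
  thus "\<sigma> = \<rho>" by (intro induced_state_inj density_in_ops) (use assms in simp_all)
qed (use assms in simp)

lemma rank_one_projection:
  assumes \<xi>: "\<xi> \<in> carrier H" and unit: "vinner H \<xi> \<xi> = 1"
  shows rank_one_positive: "rank_one H \<xi> \<in> positives (op_star_ring H)"
    and rank_one_idem: "compose (carrier H) (rank_one H \<xi>) (rank_one H \<xi>) = rank_one H \<xi>"
    and rank_one_adjoint: "op_adjoint H (rank_one H \<xi>) = rank_one H \<xi>"
proof -
  have P: "rank_one H \<xi> \<in> bounded_ops H"
    unfolding rank_one_eq_ketbra by (rule ketbra_in_ops[OF \<xi> \<xi>])
  show "op_adjoint H (rank_one H \<xi>) = rank_one H \<xi>"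
  proof (rule op_adjoint_eqI[OF P])
    fix x y assume "x \<in> carrier H" "y \<in> carrier H"
    thus "vinner H (rank_one H \<xi> x) y = vinner H x (rank_one H \<xi> y)"
      using \<xi> vinner_cnj[OF \<xi>, of x] by (simp add: rank_one_def)
  qed
  have "vscale H 1 \<xi> = \<xi>" by (rule vinner_ext) (use \<xi> in auto)
  thus "compose (carrier H) (rank_one H \<xi>) (rank_one H \<xi>) = rank_one H \<xi>"
    using \<xi> unit P by (simp add: rank_one_eq_ketbra compose_ketbra) (simp add: ketbra_def)
  show "rank_one H \<xi> \<in> positives (op_star_ring H)"
  proof (rule positiveI[OF P P])
    fix x y assume "x \<in> carrier H" "y \<in> carrier H"
    thus "vinner H x (rank_one H \<xi> y) = vinner H (rank_one H \<xi> x) (rank_one H \<xi> y)"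
      using \<xi> unit vinner_cnj[OF \<xi>, of x] by (simp add: rank_one_def)
  qed
qed

text \<open>A unit vector gives a projection \<open>P\<close>. Being its own absolute value, \<open>P\<close> has as trace norm the Parseval
  sum of \<open>\<xi>\<close>. That its square root is \<open>P\<close> is a case of the uniqueness of commuting positive roots.\<close>

lemma rank_one_density:
  assumes \<xi>: "\<xi> \<in> carrier H" and unit: "vinner H \<xi> \<xi> = 1"
  shows "rank_one H \<xi> \<in> densities (op_algebra H)"
proof -
  define P where "P = rank_one H \<xi>"
  have P: "P \<in> bounded_ops H"
    unfolding P_def rank_one_eq_ketbra by (rule ketbra_in_ops[OF \<xi> \<xi>])
  have idem: "compose (carrier H) P P = P" and adj: "op_adjoint H P = P"
    and pos: "P \<in> positives (op_star_ring H)"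
    unfolding P_def by (rule rank_one_projection[OF \<xi> unit])+
  have root: "pos_sqrt (op_star_ring H) P = P"
  proof (rule pos_sqrt_eqI[OF pos idem])
    fix T assume T: "T \<in> positives (op_star_ring H)" and TT: "compose (carrier H) T T = P"
    have "T \<in> bounded_ops H" using positive_opE[OF T] by blast
    \<comment> \<open>Both sides are the cube of \<open>T\<close>.\<close>
    thus "compose (carrier H) T P = compose (carrier H) P T"
      unfolding TT[symmetric] by (auto simp: compose_def fun_eq_iff restrict_def bounded_opD(1))
  qed
  obtain E where E: "hilbert_basis H E" using hilbert_basis_exists by blast
  have "(\<lambda>x. vinner H x (P x)) summable_on E \<longleftrightarrow> (\<lambda>x. vinner H x \<xi> * vinner H \<xi> x) summable_on E"
    by (rule summable_on_cong)
       (use \<xi> orthonormalD(1)[OF hilbert_basis_orthonormal[OF E]] in \<open>simp add: P_def rank_one_def\<close>)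
  moreover have "(\<lambda>x. vinner H x \<xi> * vinner H \<xi> x) summable_on E"
    using Parseval[OF E \<xi> \<xi>] by (auto simp: summable_on_def)
  ultimately have "P \<in> trace_class H"
    using P E by (auto simp: trace_class_def idem adj root)
  moreover have "op_trace H P = 1"
    unfolding P_def rank_one_eq_ketbra by (simp add: op_trace_ketbra \<xi> unit)
  ultimately show ?thesis using pos by (simp add: P_def)
qed

text \<open>Conditioning a pure state on \<open>e\<close> projects onto the vector \<open>S \<xi>\<close> with \<open>S\<close> the root of \<open>e\<close>:
  \<open>S\<close> being self-adjoint, \<open>S |\<xi>\<rangle>\<langle>\<xi>| S = |S \<xi>\<rangle>\<langle>S \<xi>|\<close>, and dividing by the validity
  \<open>r = \<parallel>S \<xi>\<parallel>\<^sup>2\<close> normalizes the vector.\<close>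

lemma cond_density_rank_one:
  assumes \<xi>: "\<xi> \<in> carrier H" and e: "e \<in> bounded_ops H"
    and S: "S \<in> positives (op_star_ring H)" and SS: "compose (carrier H) S S = e"
    and root: "pos_sqrt (op_star_ring H) e = S"
    and r: "vinner H \<xi> (e \<xi>) = of_real r" "0 < r"
  shows "cond_density (op_algebra H) (rank_one H \<xi>) e =
    rank_one H (vscale H (1 / of_real (sqrt r)) (S \<xi>))"
proof -
  obtain b where b: "b \<in> bounded_ops H" and So: "S \<in> bounded_ops H"
    and Sb: "\<And>x y. x \<in> carrier H \<Longrightarrow> y \<in> carrier H \<Longrightarrow> vinner H x (S y) = vinner H (b x) (b y)"
    using positive_opE[OF S] by blast
  note [simp] = bounded_opD(1)[OF b] bounded_opD(1)[OF So] bounded_opD(1)[OF e]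
  have sa: "vinner H x (S y) = vinner H (S x) y" if "x \<in> carrier H" "y \<in> carrier H" for x y
    using that Sb vinner_cnj[of y "S x"] vinner_cnj[of "b y" "b x"] by simp
  have e_eq: "e x = S (S x)" if "x \<in> carrier H" for x
    using that by (simp add: SS[symmetric] compose_def)
  have "compose (carrier H) (ketbra \<xi> \<xi>) e = ketbra \<xi> (e \<xi>)"
    by (rule ketbra_compose[OF e]) (use \<xi> sa e_eq in auto)
  moreover have "vinner H (e \<xi>) \<xi> = of_real r"
    using \<xi> vinner_cnj[of \<xi> "e \<xi>"] r(1) by simp
  ultimately have validity: "induced_state (op_algebra H) (ketbra \<xi> \<xi>) e = of_real r"
    using \<xi> e by (simp add: induced_state_def op_trace_ketbra)
  have "compose (carrier H) (compose (carrier H) S (ketbra \<xi> \<xi>)) S = ketbra (S \<xi>) (S \<xi>)"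
    unfolding compose_ketbra[OF So \<xi> \<xi>]
    by (rule ketbra_compose[OF So]) (use \<xi> sa in auto)
  hence "cond_density (op_algebra H) (rank_one H \<xi>) e =
      (\<lambda>x\<in>carrier H. vscale H (1 / of_real r) (ketbra (S \<xi>) (S \<xi>) x))"
    by (simp add: cond_density_def rank_one_eq_ketbra pos_sqrt_op_algebra root validity)
  also have "\<dots> = rank_one H (vscale H (1 / of_real (sqrt r)) (S \<xi>))"
  proof (rule bounded_op_eqI)
    fix x y assume xy: "x \<in> carrier H" "y \<in> carrier H"
    have "complex_of_real (sqrt r) * of_real (sqrt r) = of_real r"
      using r(2) by (simp flip: of_real_mult)
    hence "1 / complex_of_real r = 1 / of_real (sqrt r) * (1 / of_real (sqrt r))"
      by simp
    thus "vinner H y ((\<lambda>x\<in>carrier H. vscale H (1 / of_real r) (ketbra (S \<xi>) (S \<xi>) x)) x) =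
        vinner H y (rank_one H (vscale H (1 / of_real (sqrt r)) (S \<xi>)) x)"
      using xy \<xi> by (simp add: ketbra_def rank_one_def)
  next
    show "(\<lambda>x\<in>carrier H. vscale H (1 / of_real r) (ketbra (S \<xi>) (S \<xi>) x)) \<in> bounded_ops H"
      by (intro vscale_in_ops ketbra_in_ops bounded_opD(1)[OF So] \<xi>)
    show "rank_one H (vscale H (1 / of_real (sqrt r)) (S \<xi>)) \<in> bounded_ops H"
      unfolding rank_one_eq_ketbra
      by (intro vscale_closed ketbra_in_ops bounded_opD(1)[OF So] \<xi>)
  qed
  finally show ?thesis .
qed

end

lemma measurable_cnj [measurable (raw)]:
  "f \<in> borel_measurable M \<Longrightarrow> (\<lambda>x. cnj (f x)) \<in> borel_measurable M"
  by (rule borel_measurable_continuous_on) (auto intro: continuous_intros)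

section \<open>Classes of functions modulo equality almost everywhere\<close>

definition fclasses :: "'x measure \<Rightarrow> 'x fclass set" where
  "fclasses M = ae_class M ` borel_measurable M"

lemma repr_ae_class:
  assumes "f \<in> borel_measurable M"
  shows repr_ae_class_measurable: "repr (ae_class M f) \<in> borel_measurable M"
    and repr_ae_class_AE: "AE x in M. repr (ae_class M f) x = f x"
proof -
  have "f \<in> ae_class M f" using assms by (simp add: ae_class_def)
  hence "repr (ae_class M f) \<in> ae_class M f"
    unfolding repr_def by (rule someI[where P = "\<lambda>g. g \<in> ae_class M f"])
  thus "repr (ae_class M f) \<in> borel_measurable M" "AE x in M. repr (ae_class M f) x = f x"
    by (auto simp: ae_class_def)
qed

lemma ae_class_cong:
  assumes "AE x in M. f x = g x"
  shows "ae_class M f = ae_class M g"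
proof -
  have "(AE x in M. h x = f x) \<longleftrightarrow> (AE x in M. h x = g x)" for h
    by (rule eventually_subst) (use assms in eventually_elim, simp)
  thus ?thesis by (simp add: ae_class_def)
qed

lemma fclassI: "f \<in> borel_measurable M \<Longrightarrow> ae_class M f \<in> fclasses M"
  by (simp add: fclasses_def)

lemma repr_measurable: "F \<in> fclasses M \<Longrightarrow> repr F \<in> borel_measurable M"
  by (auto simp: fclasses_def repr_ae_class_measurable)

lemma ae_class_repr: "F \<in> fclasses M \<Longrightarrow> ae_class M (repr F) = F"
  by (auto simp: fclasses_def intro!: ae_class_cong repr_ae_class_AE)

lemma fclass_eqI:
  assumes "F \<in> fclasses M" "G \<in> fclasses M" "AE x in M. repr F x = repr G x"
  shows "F = G"
  using assms ae_class_repr ae_class_cong by metis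

lemma cls_closed2:
  assumes "F \<in> fclasses M" "G \<in> fclasses M"
  shows cls_add_closed: "cls_add M F G \<in> fclasses M"
    and cls_mult_closed: "cls_mult M F G \<in> fclasses M"
    and repr_add: "AE x in M. repr (cls_add M F G) x = repr F x + repr G x"
    and repr_mult: "AE x in M. repr (cls_mult M F G) x = repr F x * repr G x"
proof -
  note [measurable] = assms[THEN repr_measurable]
  show "cls_add M F G \<in> fclasses M" "cls_mult M F G \<in> fclasses M"
    unfolding cls_add_def cls_mult_def by (rule fclassI, measurable)+
  show "AE x in M. repr (cls_add M F G) x = repr F x + repr G x"
    "AE x in M. repr (cls_mult M F G) x = repr F x * repr G x"
    unfolding cls_add_def cls_mult_def by (rule repr_ae_class_AE, measurable)+
qed

lemma cls_closed1:
  assumes "F \<in> fclasses M"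
  shows cls_scale_closed: "cls_scale M c F \<in> fclasses M"
    and cls_cnj_closed: "cls_cnj M F \<in> fclasses M"
    and cls_sqrt_closed: "cls_sqrt M F \<in> fclasses M"
    and repr_scale: "AE x in M. repr (cls_scale M c F) x = c * repr F x"
    and repr_cnj: "AE x in M. repr (cls_cnj M F) x = cnj (repr F x)"
    and repr_sqrt: "AE x in M. repr (cls_sqrt M F) x = complex_of_real (sqrt (Re (repr F x)))"
proof -
  note [measurable] = assms[THEN repr_measurable]
  show "cls_scale M c F \<in> fclasses M" "cls_cnj M F \<in> fclasses M" "cls_sqrt M F \<in> fclasses M"
    unfolding cls_scale_def cls_cnj_def cls_sqrt_def by (rule fclassI, measurable)+
  show "AE x in M. repr (cls_scale M c F) x = c * repr F x"
    "AE x in M. repr (cls_cnj M F) x = cnj (repr F x)"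
    "AE x in M. repr (cls_sqrt M F) x = complex_of_real (sqrt (Re (repr F x)))"
    unfolding cls_scale_def cls_cnj_def cls_sqrt_def by (rule repr_ae_class_AE, measurable)+
qed

section \<open>The Hilbert space of square-integrable classes\<close>

definition sq_integrable :: "'x measure \<Rightarrow> ('x \<Rightarrow> complex) \<Rightarrow> bool" where
  "sq_integrable M f \<longleftrightarrow> f \<in> borel_measurable M \<and> integrable M (\<lambda>x. (cmod (f x))\<^sup>2)"

lemma sq_integrable_measurable: "sq_integrable M f \<Longrightarrow> f \<in> borel_measurable M"
  by (simp add: sq_integrable_def)

lemma sq_integrable_mult_bound:
  assumes f: "f \<in> borel_measurable M" and g: "sq_integrable M g"
    and C: "AE x in M. cmod (f x) \<le> C"
  shows "sq_integrable M (\<lambda>x. f x * g x)"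
proof -
  note [measurable] = f sq_integrable_measurable[OF g]
  have "integrable M (\<lambda>x. (cmod (f x * g x))\<^sup>2)"
  proof (rule Bochner_Integration.integrable_bound)
    show "integrable M (\<lambda>x. C\<^sup>2 * (cmod (g x))\<^sup>2)" using g by (simp add: sq_integrable_def)
    show "AE x in M. norm ((cmod (f x * g x))\<^sup>2) \<le> norm (C\<^sup>2 * (cmod (g x))\<^sup>2)"
      using C
    proof eventually_elim
      case (elim x)
      hence "(cmod (f x))\<^sup>2 \<le> C\<^sup>2" by (intro power_mono) auto
      thus ?case by (simp add: norm_mult power_mult_distrib mult_right_mono)
    qed
  qed measurable
  thus ?thesis by (simp add: sq_integrable_def)
qed

lemma sq_integrable_scale: "sq_integrable M f \<Longrightarrow> sq_integrable M (\<lambda>x. c * f x)"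
  by (rule sq_integrable_mult_bound[where C = "cmod c"]) auto

lemma sq_integrable_add:
  assumes f: "sq_integrable M f" and g: "sq_integrable M g"
  shows "sq_integrable M (\<lambda>x. f x + g x)"
proof -
  note [measurable] = f[THEN sq_integrable_measurable] g[THEN sq_integrable_measurable]
  have "integrable M (\<lambda>x. (cmod (f x + g x))\<^sup>2)"
  proof (rule Bochner_Integration.integrable_bound)
    show "integrable M (\<lambda>x. 2 * (cmod (f x))\<^sup>2 + 2 * (cmod (g x))\<^sup>2)"
      using f g by (simp add: sq_integrable_def)
    show "AE x in M. norm ((cmod (f x + g x))\<^sup>2) \<le> norm (2 * (cmod (f x))\<^sup>2 + 2 * (cmod (g x))\<^sup>2)"
    proof (rule AE_I2)
      fix x
      have "(cmod (f x + g x))\<^sup>2 \<le> (cmod (f x) + cmod (g x))\<^sup>2"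
        by (rule power_mono[OF norm_triangle_ineq]) simp
      moreover have "(cmod (f x) + cmod (g x))\<^sup>2 \<le> 2 * (cmod (f x))\<^sup>2 + 2 * (cmod (g x))\<^sup>2"
        using sum_squares_bound[of "cmod (f x)" "cmod (g x)"] by (simp add: power2_sum)
      ultimately have "(cmod (f x + g x))\<^sup>2 \<le> 2 * (cmod (f x))\<^sup>2 + 2 * (cmod (g x))\<^sup>2"
        by (rule order_trans)
      thus "norm ((cmod (f x + g x))\<^sup>2) \<le> norm (2 * (cmod (f x))\<^sup>2 + 2 * (cmod (g x))\<^sup>2)"
        by simp
    qed
  qed measurable
  thus ?thesis by (simp add: sq_integrable_def)
qed

lemma integrable_cnj_mult:
  assumes f: "sq_integrable M f" and g: "sq_integrable M g"
  shows "integrable M (\<lambda>x. cnj (f x) * g x)"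
proof -
  note [measurable] = f[THEN sq_integrable_measurable] g[THEN sq_integrable_measurable]
  show ?thesis
  proof (rule Bochner_Integration.integrable_bound)
    show "integrable M (\<lambda>x. (cmod (f x))\<^sup>2 + (cmod (g x))\<^sup>2)"
      using f g by (simp add: sq_integrable_def)
    have "cmod (f x) * cmod (g x) \<le> (cmod (f x))\<^sup>2 + (cmod (g x))\<^sup>2" for x
      using sum_squares_bound[of "cmod (f x)" "cmod (g x)"]
        mult_nonneg_nonneg[OF norm_ge_zero norm_ge_zero, of "f x" "g x"] by linarith
    thus "AE x in M. norm (cnj (f x) * g x) \<le> norm ((cmod (f x))\<^sup>2 + (cmod (g x))\<^sup>2)"
      by (simp add: norm_mult)
  qed measurable
qed

text \<open>Weak sequential completeness. With \<open>h n = f (Suc n) - f n\<close>, the weighted square function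
  \<open>\<Sum>n. 4 ^ n * |h n|\<^sup>2\<close> is integrable by monotone convergence. It makes the series of the \<open>h n\<close>
  converge almost everywhere, and by the Cauchy-Schwarz inequality for sums it dominates all
  \<open>|f n|\<^sup>2\<close>; dominated convergence then gives convergence of the inner products.\<close>

lemma sq_integrable_fast_limit:
  fixes f :: "nat \<Rightarrow> 'x \<Rightarrow> complex"
  assumes f: "\<And>n. sq_integrable M (f n)"
    and step: "\<And>n. (LINT x|M. (cmod (f (Suc n) x - f n x))\<^sup>2) \<le> (1/16) ^ n"
  obtains g where "sq_integrable M g"
    and "\<And>z. sq_integrable M z \<Longrightarrow> (\<lambda>n. LINT x|M. cnj (z x) * f n x) \<longlonglongrightarrow> (LINT x|M. cnj (z x) * g x)"
proof -
  note [measurable] = f[THEN sq_integrable_measurable]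
  define h where "h n x = f (Suc n) x - f n x" for n x
  define w where "w n x = 4 ^ n * (cmod (h n x))\<^sup>2" for n x
  have [measurable]: "h n \<in> borel_measurable M" "w n \<in> borel_measurable M" for n
    unfolding h_def[abs_def] w_def[abs_def] by measurable
  have w_nonneg: "0 \<le> w n x" for n x by (simp add: w_def)
  have w_eq: "w n x = (2 ^ n * cmod (h n x))\<^sup>2" for n x
  proof -
    have "((2::real) ^ n)\<^sup>2 = 4 ^ n" by (simp add: power2_eq_square flip: power_mult_distrib)
    thus ?thesis by (simp add: w_def power_mult_distrib)
  qed
  have "sq_integrable M (h n)" for n
    using sq_integrable_add[OF f[of "Suc n"] sq_integrable_scale[OF f[of n], of "-1"]]
    by (simp add: h_def[abs_def])
  hence w_int: "integrable M (w n)" for n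
    by (simp add: w_def[abs_def] sq_integrable_def)
  have w_le: "(LINT x|M. w n x) \<le> (1/4) ^ n" for n
  proof -
    have "(LINT x|M. w n x) \<le> 4 ^ n * (1/16) ^ n"
      using step[of n] by (simp add: w_def h_def mult_left_mono)
    also have "\<dots> = (1/4) ^ n" by (simp flip: power_mult_distrib)
    finally show ?thesis .
  qed
  have wi_nonneg: "0 \<le> (LINT x|M. w n x)" for n
    by (rule Bochner_Integration.integral_nonneg) (rule w_nonneg)
  have summable_int: "summable (\<lambda>n. LINT x|M. w n x)"
    by (rule summable_comparison_test'[where g = "\<lambda>n. (1/4) ^ n"])
       (use w_le wi_nonneg in \<open>auto intro!: summable_geometric\<close>)
  have "(\<integral>\<^sup>+x. (\<Sum>n. ennreal (w n x)) \<partial>M) = (\<Sum>n. \<integral>\<^sup>+x. ennreal (w n x) \<partial>M)"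
    by (rule nn_integral_suminf) measurable
  also have "\<dots> = (\<Sum>n. ennreal (LINT x|M. w n x))"
    by (simp add: nn_integral_eq_integral[OF w_int] w_nonneg)
  also have "\<dots> \<noteq> \<infinity>"
    unfolding infinity_ennreal_def by (rule ennreal_suminf_neq_top[OF summable_int wi_nonneg])
  finally have "AE x in M. (\<Sum>n. ennreal (w n x)) \<noteq> \<infinity>"
    by (intro nn_integral_noteq_infinite) measurable
  hence summable_w: "AE x in M. summable (\<lambda>n. w n x)"
    by eventually_elim (intro summable_suminf_not_top; simp add: w_nonneg)
  define W where "W x = 2 * (cmod (f 0 x))\<^sup>2 + 4 * (\<Sum>n. w n x)" for x
  have "integrable M (\<lambda>x. \<Sum>n. w n x)"
    by (rule integrable_suminf) (use w_int summable_w summable_int w_nonneg in auto)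
  hence W_int: "integrable M W"
    unfolding W_def[abs_def] using f[of 0] by (simp add: sq_integrable_def)
  have tele: "f n x = f 0 x + (\<Sum>k<n. h k x)" for n x
    by (induction n) (auto simp: h_def)
  have bound: "AE x in M. \<forall>n. (cmod (f n x))\<^sup>2 \<le> W x"
    using summable_w
  proof eventually_elim
    case (elim x)
    show ?case
    proof
      fix n
      have "(\<Sum>k<n. cmod (h k x))\<^sup>2 = (\<Sum>k<n. (1/2) ^ k * (2 ^ k * cmod (h k x)))\<^sup>2"
        by (simp add: power_divide)
      also have "\<dots> \<le> (\<Sum>k<n. ((1/2) ^ k)\<^sup>2) * (\<Sum>k<n. (2 ^ k * cmod (h k x))\<^sup>2)"
        by (rule Cauchy_Schwarz_ineq_sum)
      also have "\<dots> = (\<Sum>k<n. (1/4) ^ k) * (\<Sum>k<n. w k x)"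
        by (simp add: w_eq power2_eq_square flip: power_mult_distrib)
      also have "\<dots> \<le> 2 * (\<Sum>k. w k x)"
      proof (rule mult_mono)
        have "(\<Sum>k<n. (1/4) ^ k) \<le> (\<Sum>k. (1/4::real) ^ k)"
          by (rule sum_le_suminf) (auto intro!: summable_geometric)
        also have "\<dots> = 4/3" by (subst suminf_geometric) auto
        finally show "(\<Sum>k<n. (1/4::real) ^ k) \<le> 2" by simp
        show "(\<Sum>k<n. w k x) \<le> (\<Sum>k. w k x)"
          by (rule sum_le_suminf) (use elim w_nonneg in auto)
      qed (auto intro!: sum_nonneg w_nonneg)
      finally have hs: "(\<Sum>k<n. cmod (h k x))\<^sup>2 \<le> 2 * (\<Sum>k. w k x)" .
      have "cmod (f n x) \<le> cmod (f 0 x) + (\<Sum>k<n. cmod (h k x))"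
        unfolding tele[of n x] using norm_triangle_ineq[of "f 0 x"] norm_sum[of "\<lambda>k. h k x" "{..<n}"]
        by (smt (verit))
      hence "(cmod (f n x))\<^sup>2 \<le> (cmod (f 0 x) + (\<Sum>k<n. cmod (h k x)))\<^sup>2"
        by (intro power_mono) auto
      also have "\<dots> \<le> 2 * (cmod (f 0 x))\<^sup>2 + 2 * (\<Sum>k<n. cmod (h k x))\<^sup>2"
        using sum_squares_bound[of "cmod (f 0 x)" "\<Sum>k<n. cmod (h k x)"] by (simp add: power2_sum)
      also have "\<dots> \<le> W x" using hs by (simp add: W_def)
      finally show "(cmod (f n x))\<^sup>2 \<le> W x" .
    qed
  qed
  define g where "g x = lim (\<lambda>n. f n x)" for x
  have [measurable]: "g \<in> borel_measurable M"
    unfolding g_def[abs_def] by measurable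
  have lim: "AE x in M. (\<lambda>n. f n x) \<longlonglongrightarrow> g x"
    using summable_w
  proof eventually_elim
    case (elim x)
    have "summable (\<lambda>k. (1/4) ^ k + w k x)"
      by (intro summable_add elim summable_geometric) simp
    moreover have "cmod (h k x) \<le> (1/4) ^ k + w k x" for k
    proof -
      have "2 * ((1/2) ^ k * (2 ^ k * cmod (h k x))) \<le> ((1/2) ^ k)\<^sup>2 + (2 ^ k * cmod (h k x))\<^sup>2"
        using sum_squares_bound[of "(1/2) ^ k" "2 ^ k * cmod (h k x)"] by (simp add: mult_ac)
      also have "\<dots> = (1/4) ^ k + w k x"
        by (simp add: w_eq power2_eq_square flip: power_mult_distrib)
      finally have "2 * cmod (h k x) \<le> (1/4) ^ k + w k x" by (simp add: power_divide)
      thus ?thesis using norm_ge_zero[of "h k x"] by linarith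
    qed
    ultimately have "summable (\<lambda>k. h k x)"
      by (rule summable_comparison_test'[where N = 0])
    hence "(\<lambda>n. f 0 x + (\<Sum>k<n. h k x)) \<longlonglongrightarrow> f 0 x + (\<Sum>k. h k x)"
      by (intro tendsto_intros summable_LIMSEQ)
    hence "convergent (\<lambda>n. f n x)"
      unfolding tele[symmetric] convergent_def by blast
    thus ?case by (simp add: g_def convergent_LIMSEQ_iff)
  qed
  have "AE x in M. (cmod (g x))\<^sup>2 \<le> W x"
    using lim bound
    by eventually_elim (auto intro!: LIMSEQ_le_const2[OF tendsto_power[OF tendsto_norm]])
  hence "integrable M (\<lambda>x. (cmod (g x))\<^sup>2)"
    by (intro Bochner_Integration.integrable_bound[OF W_int]) (auto elim!: eventually_mono)
  hence g: "sq_integrable M g" by (simp add: sq_integrable_def)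
  have "(\<lambda>n. LINT x|M. cnj (z x) * f n x) \<longlonglongrightarrow> (LINT x|M. cnj (z x) * g x)"
    if z: "sq_integrable M z" for z
  proof (rule integral_dominated_convergence)
    note [measurable] = z[THEN sq_integrable_measurable]
    show "(\<lambda>x. cnj (z x) * g x) \<in> borel_measurable M"
      "(\<lambda>x. cnj (z x) * f n x) \<in> borel_measurable M" for n by measurable
    show "integrable M (\<lambda>x. (cmod (z x))\<^sup>2 + W x)"
      using z W_int by (simp add: sq_integrable_def)
    show "AE x in M. (\<lambda>n. cnj (z x) * f n x) \<longlonglongrightarrow> cnj (z x) * g x"
      using lim by eventually_elim (intro tendsto_intros)
    fix n
    show "AE x in M. norm (cnj (z x) * f n x) \<le> (cmod (z x))\<^sup>2 + W x"
      using bound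
    proof eventually_elim
      case (elim x)
      have "cmod (z x) * cmod (f n x) \<le> (cmod (z x))\<^sup>2 + (cmod (f n x))\<^sup>2"
        using sum_squares_bound[of "cmod (z x)" "cmod (f n x)"]
          mult_nonneg_nonneg[OF norm_ge_zero norm_ge_zero, of "z x" "f n x"] by linarith
      thus ?case using elim by (simp add: norm_mult) (smt (verit))
    qed
  qed
  with g show ?thesis using that by blast
qed

lemma L2_iff: "F \<in> L2 M \<longleftrightarrow> F \<in> fclasses M \<and> sq_integrable M (repr F)"
proof
  assume "F \<in> L2 M"
  then obtain f where F: "F = ae_class M f" and f: "f \<in> borel_measurable M"
    and int: "integrable M (\<lambda>x. (cmod (f x))\<^sup>2)"
    by (auto simp: L2_def)
  note [measurable] = f repr_ae_class_measurable[OF f]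
  have "AE x in M. (cmod (f x))\<^sup>2 = (cmod (repr F x))\<^sup>2"
    unfolding F using repr_ae_class_AE[OF f] by eventually_elim simp
  hence "integrable M (\<lambda>x. (cmod (repr F x))\<^sup>2)"
    unfolding F by (intro integrable_cong_AE_imp[OF int]) measurable
  thus "F \<in> fclasses M \<and> sq_integrable M (repr F)"
    by (simp add: F fclassI[OF f] sq_integrable_def)
next
  assume F: "F \<in> fclasses M \<and> sq_integrable M (repr F)"
  hence "F = ae_class M (repr F)" by (simp add: ae_class_repr)
  thus "F \<in> L2 M" using F by (auto simp: L2_def sq_integrable_def)
qed

lemma ae_class_L2: "sq_integrable M f \<Longrightarrow> ae_class M f \<in> L2 M"
  by (auto simp: L2_def sq_integrable_def)

lemma L2_space_simps [simp]:
  "carrier (L2_space M) = L2 M"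
  "vzero (L2_space M) = ae_class M (\<lambda>_. 0)"
  "vadd (L2_space M) = cls_add M"
  "vscale (L2_space M) = cls_scale M"
  "vinner (L2_space M) = (\<lambda>F G. LINT x|M. cnj (repr F x) * repr G x)"
  by (simp_all add: L2_space_def)

lemma integral_cnj_repr:
  assumes F: "sq_integrable M (repr F)" and g: "g \<in> borel_measurable M"
    and G: "G \<in> fclasses M" "AE x in M. repr G x = g x"
  shows "(LINT x|M. cnj (repr F x) * repr G x) = (LINT x|M. cnj (repr F x) * g x)"
proof -
  note [measurable] = sq_integrable_measurable[OF F] g repr_measurable[OF G(1)]
  show ?thesis
    by (rule integral_cong_AE) (measurable, use G(2) in \<open>auto elim!: eventually_mono\<close>)
qed

lemma integral_norm_sq:
  assumes "sq_integrable M f"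
  shows "(LINT x|M. cnj (f x) * f x) = of_real (LINT x|M. (cmod (f x))\<^sup>2)"
  using complex_norm_square by (simp add: mult.commute flip: integral_complex_of_real)

lemma hilbert_carrier_L2: "hilbert_carrier (L2_space M)"
proof
  note L2D = L2_iff[THEN iffD1, THEN conjunct1] L2_iff[THEN iffD1, THEN conjunct2]
  have zero: "sq_integrable M (\<lambda>_. 0)" by (simp add: sq_integrable_def)
  show "vzero (L2_space M) \<in> carrier (L2_space M)"
    by (simp add: ae_class_L2[OF zero])
  show "vadd (L2_space M) F G \<in> carrier (L2_space M)"
    if "F \<in> carrier (L2_space M)" "G \<in> carrier (L2_space M)" for F G
    using that by (simp add: cls_add_def ae_class_L2 sq_integrable_add L2D)
  show "vscale (L2_space M) c F \<in> carrier (L2_space M)" if "F \<in> carrier (L2_space M)" for F c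
    using that by (simp add: cls_scale_def ae_class_L2 sq_integrable_scale L2D)
  show "vinner (L2_space M) F (vzero (L2_space M)) = 0" if "F \<in> carrier (L2_space M)" for F
    using that integral_cnj_repr[of M F "\<lambda>_. 0" "ae_class M (\<lambda>_. 0)"]
    by (simp add: L2D fclassI repr_ae_class_AE)
  show "vinner (L2_space M) F (vadd (L2_space M) G G') =
      vinner (L2_space M) F G + vinner (L2_space M) F G'"
    if "F \<in> carrier (L2_space M)" "G \<in> carrier (L2_space M)" "G' \<in> carrier (L2_space M)" for F G G'
  proof -
    have L2: "F \<in> L2 M" "G \<in> L2 M" "G' \<in> L2 M" using that by simp_all
    note [measurable] = L2[THEN L2D(1), THEN repr_measurable]
    have "(LINT x|M. cnj (repr F x) * repr (cls_add M G G') x) =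
        (LINT x|M. cnj (repr F x) * (repr G x + repr G' x))"
      by (rule integral_cnj_repr[OF L2D(2)[OF L2(1)] _ cls_add_closed repr_add])
         (use L2D(1) L2 in auto)
    also have "\<dots> = (LINT x|M. cnj (repr F x) * repr G x) + (LINT x|M. cnj (repr F x) * repr G' x)"
      unfolding distrib_left
      by (rule Bochner_Integration.integral_add) (use L2 in \<open>auto intro!: integrable_cnj_mult L2D\<close>)
    finally show ?thesis by simp
  qed
  show "vinner (L2_space M) F (vscale (L2_space M) c G) = c * vinner (L2_space M) F G"
    if "F \<in> carrier (L2_space M)" "G \<in> carrier (L2_space M)" for F G c
  proof -
    have L2: "F \<in> L2 M" "G \<in> L2 M" using that by simp_all
    note [measurable] = L2[THEN L2D(1), THEN repr_measurable]
    have "(LINT x|M. cnj (repr F x) * repr (cls_scale M c G) x) =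
        (LINT x|M. cnj (repr F x) * (c * repr G x))"
      by (rule integral_cnj_repr[OF L2D(2)[OF L2(1)] _ cls_scale_closed repr_scale])
         (use L2D(1) L2 in auto)
    also have "\<dots> = (LINT x|M. c * (cnj (repr F x) * repr G x))"
      by (simp add: mult_ac)
    finally show ?thesis by simp
  qed
  show "vinner (L2_space M) G F = cnj (vinner (L2_space M) F G)"
    if "F \<in> carrier (L2_space M)" "G \<in> carrier (L2_space M)" for F G
    by (simp only: L2_space_simps Bochner_Integration.integral_cnj[symmetric] complex_cnj_mult complex_cnj_cnj mult.commute)
  show "0 \<le> Re (vinner (L2_space M) F F)" if "F \<in> carrier (L2_space M)" for F
    using that by (simp add: integral_norm_sq L2D)
  show "F = G" if FG: "F \<in> carrier (L2_space M)" "G \<in> carrier (L2_space M)"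
    and eq: "\<And>z. z \<in> carrier (L2_space M) \<Longrightarrow> vinner (L2_space M) z F = vinner (L2_space M) z G" for F G
  proof -
    have L2: "F \<in> L2 M" "G \<in> L2 M" using FG by simp_all
    note [measurable] = L2[THEN L2D(1), THEN repr_measurable]
    define d where "d x = repr F x - repr G x" for x
    have [measurable]: "d \<in> borel_measurable M" unfolding d_def[abs_def] by measurable
    have d: "sq_integrable M d"
      using sq_integrable_add[OF L2D(2)[OF L2(1)] sq_integrable_scale[OF L2D(2)[OF L2(2)], of "-1"]]
      by (simp add: d_def[abs_def])
    have dL2: "ae_class M d \<in> L2 M" by (rule ae_class_L2[OF d])
    note [measurable] = repr_measurable[OF L2D(1)[OF dL2]]
    have "(LINT x|M. cnj (repr (ae_class M d) x) * d x) =
        (LINT x|M. cnj (repr (ae_class M d) x) * repr F x) - (LINT x|M. cnj (repr (ae_class M d) x) * repr G x)"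
      unfolding d_def right_diff_distrib
      by (rule Bochner_Integration.integral_diff)
         (use L2 dL2 in \<open>auto intro!: integrable_cnj_mult L2D simp flip: d_def[abs_def]\<close>)
    also have "\<dots> = 0" using eq[of "ae_class M d"] dL2 by simp
    also have "(LINT x|M. cnj (repr (ae_class M d) x) * d x) = (LINT x|M. cnj (d x) * d x)"
      by (rule integral_cong_AE) (measurable, use repr_ae_class_AE[of d M] in \<open>auto elim!: eventually_mono\<close>)
    finally have "(LINT x|M. (cmod (d x))\<^sup>2) = 0"
      by (simp add: integral_norm_sq[OF d])
    hence "AE x in M. d x = 0"
      using d by (subst (asm) integral_nonneg_eq_0_iff_AE) (auto simp: sq_integrable_def)
    thus "F = G"
      by (intro fclass_eqI[OF L2D(1)[OF L2(1)] L2D(1)[OF L2(2)]]) (auto simp: d_def elim!: eventually_mono)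
  qed
  show "\<exists>G\<in>carrier (L2_space M). \<forall>z\<in>carrier (L2_space M).
      (\<lambda>n. vinner (L2_space M) z (X n)) \<longlonglongrightarrow> vinner (L2_space M) z G"
    if X: "\<And>n. X n \<in> carrier (L2_space M)"
      and step: "\<And>n. vnorm (L2_space M) (vadd (L2_space M) (X (Suc n)) (vscale (L2_space M) (-1) (X n)))
        \<le> (1/4) ^ n" for X
  proof -
    have L2: "X n \<in> L2 M" for n using X[of n] by simp
    note [measurable] = L2[THEN L2D(1), THEN repr_measurable]
    have "(LINT x|M. (cmod (repr (X (Suc n)) x - repr (X n) x))\<^sup>2) \<le> (1/16) ^ n" for n
    proof -
      define D where "D = cls_add M (X (Suc n)) (cls_scale M (-1) (X n))"
      have sc: "cls_scale M (-1) (X n) \<in> fclasses M" by (rule cls_scale_closed[OF L2D(1)[OF L2]])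
      have D: "D \<in> fclasses M" unfolding D_def by (intro cls_add_closed sc L2D L2)
      note [measurable] = repr_measurable[OF D]
      have ae: "AE x in M. repr D x = repr (X (Suc n)) x - repr (X n) x"
        using repr_add[OF L2D(1)[OF L2[of "Suc n"]] sc] repr_scale[OF L2D(1)[OF L2], where c = "-1"]
        unfolding D_def by eventually_elim simp
      have "sq_integrable M (\<lambda>x. repr (X (Suc n)) x + (-1) * repr (X n) x)"
        by (intro sq_integrable_add sq_integrable_scale L2D L2)
      hence sq: "integrable M (\<lambda>x. (cmod (repr (X (Suc n)) x - repr (X n) x))\<^sup>2)"
        by (simp add: sq_integrable_def)
      have eq: "(LINT x|M. (cmod (repr D x))\<^sup>2) = (LINT x|M. (cmod (repr (X (Suc n)) x - repr (X n) x))\<^sup>2)"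
        by (rule integral_cong_AE) (measurable, use ae in \<open>auto elim!: eventually_mono\<close>)
      have "sq_integrable M (repr D)"
        unfolding sq_integrable_def
        by (intro conjI integrable_cong_AE_imp[OF sq]; (measurable)?) (use ae in \<open>auto elim!: eventually_mono\<close>)
      hence "sqrt (LINT x|M. (cmod (repr D x))\<^sup>2) \<le> (1/4) ^ n"
        using step[of n] by (simp add: vnorm_def D_def[symmetric] integral_norm_sq)
      hence "(LINT x|M. (cmod (repr D x))\<^sup>2) \<le> ((1/4) ^ n)\<^sup>2"
        by (intro sqrt_le_D)
      also have "\<dots> = (1/16) ^ n" by (simp add: power2_eq_square flip: power_mult_distrib)
      finally show ?thesis using eq by simp
    qed
    then obtain g where g: "sq_integrable M g"
      and lim: "\<And>z. sq_integrable M z \<Longrightarrow>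
        (\<lambda>n. LINT x|M. cnj (z x) * repr (X n) x) \<longlonglongrightarrow> (LINT x|M. cnj (z x) * g x)"
      using sq_integrable_fast_limit[of M "\<lambda>n. repr (X n)"] L2D(2)[OF L2] by metis
    have "(LINT x|M. cnj (repr z x) * repr (ae_class M g) x) = (LINT x|M. cnj (repr z x) * g x)"
      if "z \<in> L2 M" for z
      by (rule integral_cnj_repr[OF L2D(2)[OF that]])
         (use g in \<open>auto intro!: fclassI repr_ae_class_AE sq_integrable_measurable\<close>)
    thus ?thesis
      using lim L2D(2) ae_class_L2[OF g] by (intro bexI[of _ "ae_class M g"]) auto
  qed
qed

section \<open>The algebra of bounded classes\<close>

lemma Linf_algebra_simps [simp]:
  "carrier (Linf_algebra M) = Linf M"
  "monoid.mult (Linf_algebra M) = cls_mult M"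
  "one (Linf_algebra M) = ae_class M (\<lambda>_. 1)"
  "zero (Linf_algebra M) = ae_class M (\<lambda>_. 0)"
  "add (Linf_algebra M) = cls_add M"
  "star (Linf_algebra M) = cls_cnj M"
  "densities (Linf_algebra M) =
    {p \<in> L1 M. (AE x in M. repr p x \<in> \<real>\<^sub>\<ge>\<^sub>0) \<and> (LINT x|M. repr p x) = 1}"
  "pairing (Linf_algebra M) = (\<lambda>p f. LINT x|M. repr f x * repr p x)"
  "lact (Linf_algebra M) = cls_mult M"
  "ract (Linf_algebra M) = cls_mult M"
  "pscale (Linf_algebra M) = cls_scale M"
  by (simp_all add: Linf_algebra_def)

lemma Linf_iff: "F \<in> Linf M \<longleftrightarrow> F \<in> fclasses M \<and> (\<exists>C. AE x in M. cmod (repr F x) \<le> C)"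
proof
  assume "F \<in> Linf M"
  then obtain f C where F: "F = ae_class M f" and f: "f \<in> borel_measurable M"
    and C: "AE x in M. cmod (f x) \<le> C"
    by (auto simp: Linf_def)
  have "AE x in M. cmod (repr F x) \<le> C"
    unfolding F using C repr_ae_class_AE[OF f] by eventually_elim simp
  thus "F \<in> fclasses M \<and> (\<exists>C. AE x in M. cmod (repr F x) \<le> C)"
    using fclassI[OF f] F by blast
next
  assume F: "F \<in> fclasses M \<and> (\<exists>C. AE x in M. cmod (repr F x) \<le> C)"
  hence "F = ae_class M (repr F)" by (simp add: ae_class_repr)
  thus "F \<in> Linf M" using F repr_measurable unfolding Linf_def by blast
qed

lemma L1_iff: "F \<in> L1 M \<longleftrightarrow> F \<in> fclasses M \<and> integrable M (repr F)"
proof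
  assume "F \<in> L1 M"
  then obtain f where F: "F = ae_class M f" and f: "integrable M f"
    by (auto simp: L1_def)
  note [measurable] = borel_measurable_integrable[OF f]
  have "AE x in M. f x = repr F x"
    unfolding F using repr_ae_class_AE[of f M] by (auto elim!: eventually_mono)
  hence "integrable M (repr F)"
    unfolding F by (intro integrable_cong_AE_imp[OF f] repr_ae_class_measurable) measurable
  thus "F \<in> fclasses M \<and> integrable M (repr F)" by (simp add: F fclassI)
next
  assume F: "F \<in> fclasses M \<and> integrable M (repr F)"
  hence "F = ae_class M (repr F)" by (simp add: ae_class_repr)
  thus "F \<in> L1 M" using F unfolding L1_def by blast
qed

lemma LinfD: "F \<in> Linf M \<Longrightarrow> F \<in> fclasses M"
  by (simp add: Linf_iff)

lemma LinfI:
  assumes "F \<in> fclasses M" "AE x in M. cmod (repr F x) \<le> C"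
  shows "F \<in> Linf M"
  using assms by (auto simp: Linf_iff)

lemma ae_class_Linf:
  assumes "f \<in> borel_measurable M" "\<And>x. cmod (f x) \<le> C"
  shows "ae_class M f \<in> Linf M"
  using assms by (auto simp: Linf_def)

lemma Linf_closed:
  assumes F: "F \<in> Linf M" and G: "G \<in> Linf M"
  shows Linf_add_closed: "cls_add M F G \<in> Linf M"
    and Linf_mult_closed: "cls_mult M F G \<in> Linf M"
    and Linf_scale_closed: "cls_scale M c F \<in> Linf M"
    and Linf_cnj_closed: "cls_cnj M F \<in> Linf M"
    and Linf_sqrt_closed: "cls_sqrt M F \<in> Linf M"
proof -
  obtain C D where C: "AE x in M. cmod (repr F x) \<le> C" and D: "AE x in M. cmod (repr G x) \<le> D"
    using F G by (auto simp: Linf_iff)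
  note FG = LinfD[OF F] LinfD[OF G]
  have "AE x in M. cmod (repr (cls_add M F G) x) \<le> C + D"
    using C D repr_add[OF FG] by eventually_elim (auto intro: norm_triangle_le)
  thus "cls_add M F G \<in> Linf M" by (rule LinfI[OF cls_add_closed[OF FG]])
  have "AE x in M. cmod (repr (cls_mult M F G) x) \<le> C * D"
    using C D repr_mult[OF FG]
    by eventually_elim (auto simp: norm_mult intro!: mult_mono intro: order_trans[OF norm_ge_zero])
  thus "cls_mult M F G \<in> Linf M" by (rule LinfI[OF cls_mult_closed[OF FG]])
  have "AE x in M. cmod (repr (cls_scale M c F) x) \<le> cmod c * C"
    using C repr_scale[OF FG(1), of c]
    by eventually_elim (auto simp: norm_mult intro!: mult_left_mono)
  thus "cls_scale M c F \<in> Linf M" by (rule LinfI[OF cls_scale_closed[OF FG(1)]])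
  have "AE x in M. cmod (repr (cls_cnj M F) x) \<le> C"
    using C repr_cnj[OF FG(1)] by eventually_elim simp
  thus "cls_cnj M F \<in> Linf M" by (rule LinfI[OF cls_cnj_closed[OF FG(1)]])
  have "AE x in M. cmod (repr (cls_sqrt M F) x) \<le> sqrt C"
    using C repr_sqrt[OF FG(1)]
  proof eventually_elim
    case (elim x)
    have "\<bar>sqrt (Re (repr F x))\<bar> = sqrt \<bar>Re (repr F x)\<bar>" by (simp add: real_sqrt_abs2 abs_if real_sqrt_minus)
    also have "\<dots> \<le> sqrt C"
      using abs_Re_le_cmod[of "repr F x"] elim by (intro real_sqrt_le_mono) linarith
    finally show ?case using elim by simp
  qed
  thus "cls_sqrt M F \<in> Linf M" by (rule LinfI[OF cls_sqrt_closed[OF FG(1)]])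
qed

lemma Linf_minus:
  assumes F: "F \<in> Linf M" and G: "G \<in> Linf M"
  shows "F \<ominus>\<^bsub>Linf_algebra M\<^esub> G = cls_add M F (cls_scale M (-1) G)"
proof -
  define N where "N = cls_scale M (-1) G"
  note Gc = LinfD[OF G]
  have N: "N \<in> Linf M" unfolding N_def by (rule Linf_scale_closed[OF G G])
  have N_ae: "AE x in M. repr N x = - repr G x"
    using repr_scale[OF Gc, of "-1"] unfolding N_def by simp
  have zero_ae: "AE x in M. repr (ae_class M (\<lambda>_. 0)) x = (0::complex)"
    by (rule repr_ae_class_AE) simp
  have "a_inv (Linf_algebra M) G = N"
    unfolding a_inv_def m_inv_def
  proof (rule the_equality, goal_cases)
    case 1
    have z: "ae_class M (\<lambda>_. 0) \<in> fclasses M" by (rule fclassI) simp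
    have "AE x in M. repr (cls_add M G N) x = repr (ae_class M (\<lambda>_. 0)) x"
      using N_ae zero_ae repr_add[OF Gc LinfD[OF N]] by eventually_elim simp
    hence "cls_add M G N = ae_class M (\<lambda>_. 0)"
      by (rule fclass_eqI[OF cls_add_closed[OF Gc LinfD[OF N]] z])
    moreover have "cls_add M N G = cls_add M G N" by (simp add: cls_add_def add.commute)
    ultimately have "cls_add M G N = ae_class M (\<lambda>_. 0)" "cls_add M N G = ae_class M (\<lambda>_. 0)"
      by simp_all
    thus ?case using N by simp
  next
    case (2 K)
    hence K: "K \<in> Linf M" and eq: "cls_add M G K = ae_class M (\<lambda>_. 0)" by auto
    have "AE x in M. repr K x = repr N x"
      using N_ae zero_ae repr_add[OF Gc LinfD[OF K]] unfolding eq
      by eventually_elim (simp add: add_eq_0_iff)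
    thus ?case by (rule fclass_eqI[OF LinfD[OF K] LinfD[OF N]])
  qed
  thus ?thesis by (simp add: a_minus_def N_def)
qed

lemma cls_sqrt_square:
  assumes F: "F \<in> fclasses M" and nonneg: "AE x in M. repr F x \<in> \<real>\<^sub>\<ge>\<^sub>0"
  shows "cls_mult M (cls_sqrt M F) (cls_sqrt M F) = F"
proof (rule fclass_eqI)
  show "cls_mult M (cls_sqrt M F) (cls_sqrt M F) \<in> fclasses M" "F \<in> fclasses M"
    by (intro cls_mult_closed cls_sqrt_closed F)+
  show "AE x in M. repr (cls_mult M (cls_sqrt M F) (cls_sqrt M F)) x = repr F x"
    using repr_mult[OF cls_sqrt_closed[OF F] cls_sqrt_closed[OF F]] repr_sqrt[OF F] nonneg
    by eventually_elim (auto elim!: nonneg_Reals_cases simp flip: of_real_mult)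
qed

lemma cls_sqrt_nonneg:
  assumes "F \<in> fclasses M" "AE x in M. repr F x \<in> \<real>\<^sub>\<ge>\<^sub>0"
  shows "AE x in M. repr (cls_sqrt M F) x \<in> \<real>\<^sub>\<ge>\<^sub>0"
  using assms(2) repr_sqrt[OF assms(1)]
  by eventually_elim (auto elim!: nonneg_Reals_cases)

lemma positives_Linf_iff:
  "F \<in> positives (Linf_algebra M) \<longleftrightarrow> F \<in> Linf M \<and> (AE x in M. repr F x \<in> \<real>\<^sub>\<ge>\<^sub>0)"
proof
  assume "F \<in> positives (Linf_algebra M)"
  then obtain b where b: "b \<in> Linf M" and F: "F = cls_mult M (cls_cnj M b) b"
    by (auto simp: positives_def)
  note bc = LinfD[OF b]
  have "AE x in M. repr F x \<in> \<real>\<^sub>\<ge>\<^sub>0"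
    using repr_mult[OF cls_cnj_closed[OF bc] bc] repr_cnj[OF bc] unfolding F
    by eventually_elim (simp add: complex_nonneg_Reals_iff)
  thus "F \<in> Linf M \<and> (AE x in M. repr F x \<in> \<real>\<^sub>\<ge>\<^sub>0)"
    using Linf_mult_closed[OF Linf_cnj_closed[OF b b] b] F by simp
next
  assume "F \<in> Linf M \<and> (AE x in M. repr F x \<in> \<real>\<^sub>\<ge>\<^sub>0)"
  hence F: "F \<in> Linf M" and nonneg: "AE x in M. repr F x \<in> \<real>\<^sub>\<ge>\<^sub>0" by simp_all
  note Fc = LinfD[OF F]
  have "cls_cnj M (cls_sqrt M F) = cls_sqrt M F"
  proof (rule fclass_eqI)
    show "AE x in M. repr (cls_cnj M (cls_sqrt M F)) x = repr (cls_sqrt M F) x"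
      using repr_cnj[OF cls_sqrt_closed[OF Fc]] repr_sqrt[OF Fc] by eventually_elim simp
  qed (intro cls_cnj_closed cls_sqrt_closed Fc)+
  hence "F = cls_mult M (cls_cnj M (cls_sqrt M F)) (cls_sqrt M F)"
    by (simp add: cls_sqrt_square[OF Fc nonneg])
  thus "F \<in> positives (Linf_algebra M)"
    using Linf_sqrt_closed[OF F F] unfolding positives_def by auto
qed

lemma pos_sqrt_Linf:
  assumes "F \<in> positives (Linf_algebra M)"
  shows "pos_sqrt (Linf_algebra M) F = cls_sqrt M F"
  unfolding pos_sqrt_def
proof (rule the_equality)
  have F: "F \<in> Linf M" and nonneg: "AE x in M. repr F x \<in> \<real>\<^sub>\<ge>\<^sub>0"
    using assms by (simp_all add: positives_Linf_iff)
  note Fc = LinfD[OF F]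
  show "cls_sqrt M F \<in> positives (Linf_algebra M) \<and>
      cls_sqrt M F \<otimes>\<^bsub>Linf_algebra M\<^esub> cls_sqrt M F = F"
    using Linf_sqrt_closed[OF F F] cls_sqrt_nonneg[OF Fc nonneg] cls_sqrt_square[OF Fc nonneg]
    by (simp add: positives_Linf_iff)
  fix b assume "b \<in> positives (Linf_algebra M) \<and> b \<otimes>\<^bsub>Linf_algebra M\<^esub> b = F"
  hence b: "b \<in> fclasses M" and b_nonneg: "AE x in M. repr b x \<in> \<real>\<^sub>\<ge>\<^sub>0" and sq: "cls_mult M b b = F"
    by (auto simp: positives_Linf_iff LinfD)
  have "AE x in M. repr b x = repr (cls_sqrt M F) x"
    using repr_mult[OF b b] b_nonneg repr_sqrt[OF Fc] unfolding sq
    by eventually_elim (auto elim!: nonneg_Reals_cases simp flip: of_real_mult)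
  thus "b = cls_sqrt M F" by (rule fclass_eqI[OF b cls_sqrt_closed[OF Fc]])
qed

text \<open>The difference \<open>d\<close> of two densities with the same state is tested against the bounded
  function \<open>cnj d / (1 + |d|)\<close>, which makes the integrand nonnegative and zero only where \<open>d\<close> is.\<close>

lemma Linf_induced_state_inj:
  assumes p: "p \<in> L1 M" and q: "q \<in> L1 M"
    and eq: "induced_state (Linf_algebra M) p = induced_state (Linf_algebra M) q"
  shows "p = q"
proof -
  have pq: "p \<in> fclasses M" "q \<in> fclasses M" "integrable M (repr p)" "integrable M (repr q)"
    using p q by (simp_all add: L1_iff)
  note [measurable] = repr_measurable[OF pq(1)] repr_measurable[OF pq(2)]
  define d where "d x = repr p x - repr q x" for x
  define t where "t x = cnj (d x) / of_real (1 + cmod (d x))" for x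
  have [measurable]: "d \<in> borel_measurable M" "t \<in> borel_measurable M"
    unfolding d_def[abs_def] t_def[abs_def] by measurable
  have d_int: "integrable M d" unfolding d_def[abs_def] using pq by simp
  have t_le: "cmod (t x) \<le> 1" for x
  proof -
    have "0 < 1 + cmod (d x)" by (rule add_pos_nonneg) simp_all
    thus ?thesis by (simp add: t_def norm_divide divide_le_eq_1 del: of_real_add)
  qed
  define f where "f = ae_class M t"
  have f: "f \<in> Linf M" unfolding f_def by (rule ae_class_Linf[OF _ t_le]) measurable
  note [measurable] = repr_measurable[OF LinfD[OF f]]
  have f_ae: "AE x in M. repr f x = t x" unfolding f_def by (rule repr_ae_class_AE) measurable
  have int: "integrable M (\<lambda>x. t x * u x)" if u: "integrable M u" for u :: "_ \<Rightarrow> complex"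
  proof (rule Bochner_Integration.integrable_bound[OF u])
    note [measurable] = borel_measurable_integrable[OF u]
    show "(\<lambda>x. t x * u x) \<in> borel_measurable M" by measurable
    show "AE x in M. norm (t x * u x) \<le> norm (u x)"
      using t_le by (simp add: norm_mult mult_left_le_one_le)
  qed
  have conv: "(LINT x|M. repr f x * repr p' x) = (LINT x|M. t x * repr p' x)" if "p' \<in> fclasses M" for p'
  proof -
    note [measurable] = repr_measurable[OF that]
    show ?thesis by (rule integral_cong_AE) (measurable, use f_ae in \<open>auto elim!: eventually_mono\<close>)
  qed
  have "(LINT x|M. repr f x * repr p x) = (LINT x|M. repr f x * repr q x)"
    using fun_cong[OF eq, of f] f by (simp add: induced_state_def)
  hence "(LINT x|M. t x * repr p x) - (LINT x|M. t x * repr q x) = 0"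
    using pq by (simp add: conv)
  hence "(LINT x|M. t x * d x) = 0"
    unfolding d_def right_diff_distrib
    by (subst Bochner_Integration.integral_diff) (use int pq in auto)
  moreover have td: "t x * d x = of_real ((cmod (d x))\<^sup>2 / (1 + cmod (d x)))" for x
    by (simp add: t_def of_real_cmod_sq mult.commute)
  ultimately have "(LINT x|M. (cmod (d x))\<^sup>2 / (1 + cmod (d x))) = 0"
    by (simp only: td integral_complex_of_real of_real_eq_0_iff)
  moreover have "integrable M (\<lambda>x. (cmod (d x))\<^sup>2 / (1 + cmod (d x)))"
    using int[OF d_int] by (simp only: td complex_of_real_integrable_eq)
  ultimately have "AE x in M. (cmod (d x))\<^sup>2 / (1 + cmod (d x)) = 0"
    by (subst (asm) integral_nonneg_eq_0_iff_AE) auto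
  hence "AE x in M. repr p x = repr q x"
  proof eventually_elim
    case (elim x)
    hence "d x = 0" using add_pos_nonneg[OF zero_less_one norm_ge_zero[of "d x"]] by auto
    thus ?case by (simp add: d_def)
  qed
  thus ?thesis by (rule fclass_eqI[OF pq(1,2)])
qed

lemma density_of_Linf:
  assumes "p \<in> densities (Linf_algebra M)"
  shows "density_of (Linf_algebra M) (induced_state (Linf_algebra M) p) = p"
  unfolding density_of_def
proof (rule the_equality)
  fix q assume "q \<in> densities (Linf_algebra M) \<and>
    induced_state (Linf_algebra M) q = induced_state (Linf_algebra M) p"
  thus "q = p" by (intro Linf_induced_state_inj[of q M p]) (use assms in simp_all)
qed (use assms in simp)

section \<open>The multiplication representation\<close>

lemma L2D:
  assumes "F \<in> L2 M"
  shows L2_fclass: "F \<in> fclasses M" and L2_sq_integrable: "sq_integrable M (repr F)"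
  using assms by (simp_all add: L2_iff)

interpretation L2: hilbert_carrier "L2_space M" for M :: "'x measure"
  by (rule hilbert_carrier_L2)

lemma mult_rep_apply:
  assumes f: "f \<in> Linf M" and g: "g \<in> L2 M"
  shows mult_rep_closed: "mult_rep M f g \<in> L2 M"
    and repr_mult_rep: "AE x in M. repr (mult_rep M f g) x = repr f x * repr g x"
proof -
  have eq: "mult_rep M f g = cls_mult M f g" using g by (simp add: mult_rep_def)
  obtain C where C: "AE x in M. cmod (repr f x) \<le> C" using f by (auto simp: Linf_iff)
  have "sq_integrable M (\<lambda>x. repr f x * repr g x)"
    by (rule sq_integrable_mult_bound[OF repr_measurable[OF LinfD[OF f]] L2_sq_integrable[OF g] C])
  thus "mult_rep M f g \<in> L2 M" unfolding eq cls_mult_def by (rule ae_class_L2)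
  show "AE x in M. repr (mult_rep M f g) x = repr f x * repr g x"
    unfolding eq by (rule repr_mult[OF LinfD[OF f] L2_fclass[OF g]])
qed

lemma vinner_mult_rep:
  assumes f: "f \<in> Linf M" and g: "g \<in> L2 M" and h: "h \<in> L2 M"
  shows "vinner (L2_space M) h (mult_rep M f g) =
    (LINT x|M. cnj (repr h x) * (repr f x * repr g x))"
proof -
  note [measurable] = repr_measurable[OF LinfD[OF f]] repr_measurable[OF L2_fclass[OF g]]
  show ?thesis
    unfolding L2_space_simps
    by (rule integral_cnj_repr[OF L2_sq_integrable[OF h] _ L2_fclass[OF mult_rep_closed[OF f g]]
          repr_mult_rep[OF f g]]) measurable
qed

lemma mult_rep_extensional: "mult_rep M f \<in> extensional (L2 M)"
  by (simp add: mult_rep_def)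

lemma L2_eqI:
  assumes "F \<in> L2 M" "G \<in> L2 M" "AE x in M. repr F x = repr G x"
  shows "F = G"
  by (rule fclass_eqI[OF L2_fclass[OF assms(1)] L2_fclass[OF assms(2)] assms(3)])

lemma mult_rep_in_ops:
  assumes f: "f \<in> Linf M"
  shows "mult_rep M f \<in> bounded_ops (L2_space M)"
proof -
  obtain C where C: "AE x in M. cmod (repr f x) \<le> C" using f by (auto simp: Linf_iff)
  define D where "D = max C 0"
  have D: "AE x in M. cmod (repr f x) \<le> D" "0 \<le> D"
    using C by (auto simp: D_def elim!: eventually_mono)
  have add: "mult_rep M f (cls_add M g h) = cls_add M (mult_rep M f g) (mult_rep M f h)"
    if g: "g \<in> L2 M" and h: "h \<in> L2 M" for g h
  proof (rule L2_eqI)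
    have gh: "cls_add M g h \<in> L2 M" using L2.vadd_closed[of g M h] g h by simp
    show "mult_rep M f (cls_add M g h) \<in> L2 M" by (rule mult_rep_closed[OF f gh])
    show "cls_add M (mult_rep M f g) (mult_rep M f h) \<in> L2 M"
      using L2.vadd_closed[of "mult_rep M f g" M "mult_rep M f h"] mult_rep_closed[OF f] g h by simp
    show "AE x in M. repr (mult_rep M f (cls_add M g h)) x =
        repr (cls_add M (mult_rep M f g) (mult_rep M f h)) x"
      using repr_mult_rep[OF f gh] repr_mult_rep[OF f g] repr_mult_rep[OF f h]
        repr_add[OF L2_fclass[OF g] L2_fclass[OF h]]
        repr_add[OF L2_fclass[OF mult_rep_closed[OF f g]] L2_fclass[OF mult_rep_closed[OF f h]]]
      by eventually_elim (simp add: distrib_left)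
  qed
  have scale: "mult_rep M f (cls_scale M c g) = cls_scale M c (mult_rep M f g)"
    if g: "g \<in> L2 M" for g c
  proof (rule L2_eqI)
    have cg: "cls_scale M c g \<in> L2 M" using L2.vscale_closed[of g M c] g by simp
    show "mult_rep M f (cls_scale M c g) \<in> L2 M" by (rule mult_rep_closed[OF f cg])
    show "cls_scale M c (mult_rep M f g) \<in> L2 M"
      using L2.vscale_closed[of "mult_rep M f g" M c] mult_rep_closed[OF f g] by simp
    show "AE x in M. repr (mult_rep M f (cls_scale M c g)) x = repr (cls_scale M c (mult_rep M f g)) x"
      using repr_mult_rep[OF f cg] repr_mult_rep[OF f g] repr_scale[OF L2_fclass[OF g], of c]
        repr_scale[OF L2_fclass[OF mult_rep_closed[OF f g]], of c]
      by eventually_elim simp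
  qed
  have bound: "vnorm (L2_space M) (mult_rep M f g) \<le> D * vnorm (L2_space M) g" if g: "g \<in> L2 M" for g
  proof (rule power2_le_imp_le)
    define k where "k = mult_rep M f g"
    have k: "k \<in> L2 M" unfolding k_def by (rule mult_rep_closed[OF f g])
    have "(LINT x|M. (cmod (repr k x))\<^sup>2) \<le> (LINT x|M. D\<^sup>2 * (cmod (repr g x))\<^sup>2)"
    proof (rule integral_mono_AE)
      show "integrable M (\<lambda>x. (cmod (repr k x))\<^sup>2)" "integrable M (\<lambda>x. D\<^sup>2 * (cmod (repr g x))\<^sup>2)"
        using L2_sq_integrable[OF k] L2_sq_integrable[OF g] by (simp_all add: sq_integrable_def)
      show "AE x in M. (cmod (repr k x))\<^sup>2 \<le> D\<^sup>2 * (cmod (repr g x))\<^sup>2"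
        using D(1) repr_mult_rep[OF f g] unfolding k_def
        by eventually_elim (simp add: norm_mult power_mult_distrib power_mono mult_right_mono)
    qed
    thus "(vnorm (L2_space M) (mult_rep M f g))\<^sup>2 \<le> (D * vnorm (L2_space M) g)\<^sup>2"
      using g k by (simp add: L2.vnorm_sq power_mult_distrib integral_norm_sq L2_sq_integrable
          flip: k_def)
  qed (use D(2) g in \<open>simp add: L2.vnorm_nonneg\<close>)
  show ?thesis
    unfolding bounded_ops_def
    using add scale mult_rep_closed[OF f] mult_rep_extensional
    by (auto simp: PiE_def intro!: exI[of _ D] bound)
qed

lemma mult_rep_mult:
  assumes f: "f \<in> Linf M" and g: "g \<in> Linf M"
  shows "mult_rep M (cls_mult M f g) = compose (L2 M) (mult_rep M f) (mult_rep M g)"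
proof (rule extensionalityI[OF mult_rep_extensional compose_extensional])
  fix h assume h: "h \<in> L2 M"
  note fg = Linf_mult_closed[OF f g] and gh = mult_rep_closed[OF g h]
  have "mult_rep M (cls_mult M f g) h = mult_rep M f (mult_rep M g h)"
  proof (rule L2_eqI[OF mult_rep_closed[OF fg h] mult_rep_closed[OF f gh]])
    show "AE x in M. repr (mult_rep M (cls_mult M f g) h) x = repr (mult_rep M f (mult_rep M g h)) x"
      using repr_mult_rep[OF fg h] repr_mult_rep[OF f gh] repr_mult_rep[OF g h]
        repr_mult[OF LinfD[OF f] LinfD[OF g]]
      by eventually_elim simp
  qed
  thus "mult_rep M (cls_mult M f g) h = compose (L2 M) (mult_rep M f) (mult_rep M g) h"
    using h by (simp add: compose_def)
qed

lemma mult_rep_cnj: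
  assumes f: "f \<in> Linf M"
  shows "op_adjoint (L2_space M) (mult_rep M f) = mult_rep M (cls_cnj M f)"
proof (rule L2.op_adjoint_eqI)
  have f': "cls_cnj M f \<in> Linf M" by (rule Linf_cnj_closed[OF f f])
  show "mult_rep M (cls_cnj M f) \<in> bounded_ops (L2_space M)"
    by (rule mult_rep_in_ops[OF f'])
  fix g h assume "g \<in> carrier (L2_space M)" "h \<in> carrier (L2_space M)"
  hence g: "g \<in> L2 M" and h: "h \<in> L2 M" by simp_all
  note [measurable] = repr_measurable[OF LinfD[OF f]] repr_measurable[OF L2_fclass[OF g]]
    repr_measurable[OF L2_fclass[OF h]] repr_measurable[OF L2_fclass[OF mult_rep_closed[OF f' g]]]
  have "(LINT x|M. cnj (repr (mult_rep M (cls_cnj M f) g) x) * repr h x) =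
      (LINT x|M. cnj (repr g x) * (repr f x * repr h x))"
  proof (rule integral_cong_AE)
    show "AE x in M. cnj (repr (mult_rep M (cls_cnj M f) g) x) * repr h x =
        cnj (repr g x) * (repr f x * repr h x)"
      using repr_mult_rep[OF f' g] repr_cnj[OF LinfD[OF f]] by eventually_elim simp
  qed measurable
  thus "vinner (L2_space M) (mult_rep M (cls_cnj M f) g) h =
      vinner (L2_space M) g (mult_rep M f h)"
    using vinner_mult_rep[OF f h g] by simp
qed

lemma mult_rep_const:
  "mult_rep M (ae_class M (\<lambda>_. c)) = (\<lambda>g\<in>L2 M. cls_scale M c g)"
proof (rule extensionalityI[OF mult_rep_extensional restrict_extensional])
  fix g assume g: "g \<in> L2 M"
  have k: "ae_class M (\<lambda>_. c) \<in> Linf M" by (rule ae_class_Linf[where C = "cmod c"]) auto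
  have "mult_rep M (ae_class M (\<lambda>_. c)) g = cls_scale M c g"
  proof (rule L2_eqI[OF mult_rep_closed[OF k g]])
    show "cls_scale M c g \<in> L2 M" using L2.vscale_closed[of g M c] g by simp
    have "AE x in M. repr (ae_class M (\<lambda>_. c)) x = c" by (rule repr_ae_class_AE) simp
    thus "AE x in M. repr (mult_rep M (ae_class M (\<lambda>_. c)) g) x = repr (cls_scale M c g) x"
      using repr_mult_rep[OF k g] repr_scale[OF L2_fclass[OF g], of c] by eventually_elim simp
  qed
  thus "mult_rep M (ae_class M (\<lambda>_. c)) g = (\<lambda>g\<in>L2 M. cls_scale M c g) g" using g by simp
qed

lemma mult_rep_zero: "mult_rep M \<zero>\<^bsub>Linf_algebra M\<^esub> = \<zero>\<^bsub>BL2_algebra M\<^esub>"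
  and mult_rep_one: "mult_rep M \<one>\<^bsub>Linf_algebra M\<^esub> = \<one>\<^bsub>BL2_algebra M\<^esub>"
proof -
  have "cls_scale M 0 g = ae_class M (\<lambda>_. 0)" for g by (simp add: cls_scale_def)
  moreover have "cls_scale M 1 g = g" if "g \<in> L2 M" for g
    using ae_class_repr[OF L2_fclass[OF that]] by (simp add: cls_scale_def)
  ultimately show "mult_rep M \<zero>\<^bsub>Linf_algebra M\<^esub> = \<zero>\<^bsub>BL2_algebra M\<^esub>"
    "mult_rep M \<one>\<^bsub>Linf_algebra M\<^esub> = \<one>\<^bsub>BL2_algebra M\<^esub>"
    by (auto simp: mult_rep_const restrict_def fun_eq_iff)
qed

lemma mult_rep_minus:
  assumes f: "f \<in> Linf M" and g: "g \<in> Linf M"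
  shows "mult_rep M (f \<ominus>\<^bsub>Linf_algebra M\<^esub> g) = mult_rep M f \<ominus>\<^bsub>BL2_algebra M\<^esub> mult_rep M g"
  unfolding Linf_minus[OF f g] L2.op_algebra_minus[OF mult_rep_in_ops[OF f] mult_rep_in_ops[OF g]]
    L2_space_simps
proof (rule extensionalityI[OF mult_rep_extensional restrict_extensional])
  fix h assume h: "h \<in> L2 M"
  define d k where "d = cls_add M f (cls_scale M (-1) g)" and "k = cls_scale M (-1) (mult_rep M g h)"
  have g': "cls_scale M (-1) g \<in> Linf M" by (rule Linf_scale_closed[OF g g])
  have d: "d \<in> Linf M" unfolding d_def by (rule Linf_add_closed[OF f g'])
  have k: "k \<in> L2 M"
    using L2.vscale_closed[of "mult_rep M g h" M "-1"] mult_rep_closed[OF g h] by (simp add: k_def)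
  have "mult_rep M d h = cls_add M (mult_rep M f h) k"
  proof (rule L2_eqI[OF mult_rep_closed[OF d h]])
    show "cls_add M (mult_rep M f h) k \<in> L2 M"
      using L2.vadd_closed[of "mult_rep M f h" M k] mult_rep_closed[OF f h] k by simp
    have "AE x in M. repr d x = repr f x - repr g x"
      using repr_add[OF LinfD[OF f] LinfD[OF g']] repr_scale[OF LinfD[OF g], of "-1"]
      unfolding d_def by eventually_elim simp
    moreover have "AE x in M. repr k x = - (repr g x * repr h x)"
      using repr_scale[OF L2_fclass[OF mult_rep_closed[OF g h]], of "-1"] repr_mult_rep[OF g h]
      unfolding k_def by eventually_elim simp
    ultimately show "AE x in M. repr (mult_rep M d h) x = repr (cls_add M (mult_rep M f h) k) x"
      using repr_mult_rep[OF d h] repr_mult_rep[OF f h]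
        repr_add[OF L2_fclass[OF mult_rep_closed[OF f h]] L2_fclass[OF k]]
      by eventually_elim (simp add: left_diff_distrib)
  qed
  thus "mult_rep M (cls_add M f (cls_scale M (-1) g)) h =
      (\<lambda>x\<in>L2 M. cls_add M (mult_rep M f x) (cls_scale M (-1) (mult_rep M g x))) h"
    using h by (simp add: d_def k_def)
qed

text \<open>A star homomorphism sends \<open>b\<^sup>* b\<close> to an element of the same form, hence preserves the order.\<close>

lemma mult_rep_positive:
  assumes "f \<in> positives (Linf_algebra M)"
  shows "mult_rep M f \<in> positives (op_star_ring (L2_space M))"
proof -
  obtain b where b: "b \<in> Linf M" and f: "f = cls_mult M (cls_cnj M b) b"
    using assms by (auto simp: positives_def)
  have "mult_rep M f = compose (L2 M) (op_adjoint (L2_space M) (mult_rep M b)) (mult_rep M b)"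
    unfolding f mult_rep_cnj[OF b] by (rule mult_rep_mult[OF Linf_cnj_closed[OF b b] b])
  thus ?thesis using mult_rep_in_ops[OF b] unfolding positives_def by auto
qed

lemma mult_rep_mono:
  assumes "alg_le (Linf_algebra M) f g"
  shows "alg_le (BL2_algebra M) (mult_rep M f) (mult_rep M g)"
proof -
  have f: "f \<in> Linf M" and g: "g \<in> Linf M"
    and pos: "g \<ominus>\<^bsub>Linf_algebra M\<^esub> f \<in> positives (Linf_algebra M)"
    using assms by (simp_all add: alg_le_def)
  show ?thesis
    using mult_rep_positive[OF pos] mult_rep_in_ops[OF f] mult_rep_in_ops[OF g]
    by (simp add: alg_le_def mult_rep_minus[OF g f] L2.positives_op_algebra)
qed

lemma mult_rep_effects:
  assumes "e \<in> effects (Linf_algebra M)"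
  shows "mult_rep M e \<in> effects (BL2_algebra M)"
proof -
  have le: "alg_le (Linf_algebra M) \<zero>\<^bsub>Linf_algebra M\<^esub> e" "alg_le (Linf_algebra M) e \<one>\<^bsub>Linf_algebra M\<^esub>"
    and e: "e \<in> Linf M"
    using assms by (simp_all add: effects_def)
  show ?thesis
    using le[THEN mult_rep_mono] mult_rep_in_ops[OF e]
    unfolding effects_def mult_rep_zero mult_rep_one by simp
qed

lemma effect_Linf:
  assumes "e \<in> effects (Linf_algebra M)"
  shows "e \<in> positives (Linf_algebra M)"
    and "e \<in> Linf M"
    and "AE x in M. repr e x = of_real (Re (repr e x)) \<and> 0 \<le> Re (repr e x) \<and> Re (repr e x) \<le> 1"
proof -
  have le: "e \<ominus>\<^bsub>Linf_algebra M\<^esub> ae_class M (\<lambda>_. 0) \<in> positives (Linf_algebra M)"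
      "ae_class M (\<lambda>_. 1) \<ominus>\<^bsub>Linf_algebra M\<^esub> e \<in> positives (Linf_algebra M)"
    and e: "e \<in> Linf M"
    using assms by (auto simp: effects_def alg_le_def)
  have const: "ae_class M (\<lambda>_. c) \<in> Linf M" for c :: complex
    by (rule ae_class_Linf[where C = "cmod c"]) auto
  have const_ae: "AE x in M. repr (ae_class M (\<lambda>_. c)) x = c" for c :: complex
    by (rule repr_ae_class_AE) simp
  have minus: "AE x in M. repr (F \<ominus>\<^bsub>Linf_algebra M\<^esub> G) x = repr F x - repr G x"
    if "F \<in> Linf M" "G \<in> Linf M" for F G
    using repr_add[OF LinfD[OF that(1)] cls_scale_closed[OF LinfD[OF that(2)], of "-1"]]
      repr_scale[OF LinfD[OF that(2)], of "-1"]
    unfolding Linf_minus[OF that] by eventually_elim simp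
  show e': "e \<in> Linf M" by (rule e)
  have nonneg: "AE x in M. repr e x \<in> \<real>\<^sub>\<ge>\<^sub>0"
    using le(1)[unfolded positives_Linf_iff, THEN conjunct2] minus[OF e const[of 0]] const_ae[of 0]
    by eventually_elim (simp only: diff_zero)
  thus "e \<in> positives (Linf_algebra M)" using e by (simp add: positives_Linf_iff)
  show "AE x in M. repr e x = of_real (Re (repr e x)) \<and> 0 \<le> Re (repr e x) \<and> Re (repr e x) \<le> 1"
    using le(2)[unfolded positives_Linf_iff, THEN conjunct2] minus[OF const[of 1] e] const_ae[of 1] nonneg
    by eventually_elim (simp add: complex_nonneg_Reals_iff complex_eq_iff)
qed

section \<open>The square root of a multiplication operator\<close>

text \<open>By the Weierstrass approximation theorem, moments on a bounded interval determine integrals of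
  continuous functions.\<close>

lemma moments_zero_imp:
  fixes r :: "'x \<Rightarrow> real" and u :: "'x \<Rightarrow> complex"
  assumes u: "integrable M u" and r: "r \<in> borel_measurable M"
    and range: "AE x in M. 0 \<le> r x \<and> r x \<le> 1"
    and moments: "\<And>n. (LINT x|M. of_real (r x ^ n) * u x) = 0"
    and \<phi>: "continuous_on UNIV \<phi>"
  shows "(LINT x|M. of_real (\<phi> (r x)) * u x) = 0"
proof -
  note [measurable] = borel_measurable_integrable[OF u] r
  have [measurable]: "(\<lambda>x. \<phi> (r x)) \<in> borel_measurable M"
    by (rule borel_measurable_continuous_on[OF \<phi> r])
  define K where "K = (LINT x|M. cmod (u x))"
  have le: "cmod (LINT x|M. of_real (\<phi> (r x)) * u x) \<le> \<epsilon> * K" if \<epsilon>: "0 < \<epsilon>" for \<epsilon>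
  proof -
    obtain p where p: "real_polynomial_function p" and close: "\<And>t. t \<in> {0..1} \<Longrightarrow> \<bar>\<phi> t - p t\<bar> < \<epsilon>"
      using Stone_Weierstrass_real_polynomial_function[of "{0..1}" \<phi> \<epsilon>]
        continuous_on_subset[OF \<phi>] \<epsilon> by auto
    obtain a n where a: "p = (\<lambda>t. \<Sum>i\<le>n. a i * t ^ i)"
      using p by (auto simp: real_polynomial_function_iff_sum)
    have pow_int: "integrable M (\<lambda>x. of_real (r x ^ i) * u x)" for i
    proof (rule Bochner_Integration.integrable_bound[OF u])
      show "AE x in M. norm (of_real (r x ^ i) * u x) \<le> norm (u x)"
        using range by eventually_elim (auto simp: norm_mult norm_power power_le_one intro!: mult_left_le_one_le)
    qed measurable
    have p_eq: "of_real (p (r x)) * u x = (\<Sum>i\<le>n. of_real (a i) * (of_real (r x ^ i) * u x))" for x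
      by (simp add: a sum_distrib_right mult.assoc)
    have p_int: "integrable M (\<lambda>x. of_real (p (r x)) * u x)"
      unfolding p_eq by (intro Bochner_Integration.integrable_sum integrable_mult_right pow_int)
    have p0: "(LINT x|M. of_real (p (r x)) * u x) = 0"
      unfolding p_eq by (subst Bochner_Integration.integral_sum) (simp_all only: integral_mult_right_zero
        moments integrable_mult_right pow_int mult_zero_right sum.neutral_const)
    have [measurable]: "(\<lambda>x. p (r x)) \<in> borel_measurable M" unfolding a by measurable
    define v where "v x = of_real (\<phi> (r x)) * u x - of_real (p (r x)) * u x" for x
    have [measurable]: "v \<in> borel_measurable M" unfolding v_def[abs_def] by measurable
    have v_le: "AE x in M. norm (v x) \<le> \<epsilon> * cmod (u x)"
      using range
    proof eventually_elim
      case (elim x)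
      have "v x = of_real (\<phi> (r x) - p (r x)) * u x" by (simp add: v_def left_diff_distrib)
      thus ?case using close[of "r x"] elim by (simp add: norm_mult mult_right_mono del: of_real_diff)
    qed
    have \<epsilon>u: "integrable M (\<lambda>x. \<epsilon> * cmod (u x))" using u by simp
    have v_int: "integrable M v"
      by (rule Bochner_Integration.integrable_bound[OF \<epsilon>u]) (measurable, use v_le in \<open>auto elim!: eventually_mono\<close>)
    have "(LINT x|M. of_real (\<phi> (r x)) * u x) = (LINT x|M. v x + of_real (p (r x)) * u x)"
      by (simp add: v_def)
    also have "\<dots> = (LINT x|M. v x)"
      by (subst Bochner_Integration.integral_add[OF v_int p_int]) (simp add: p0)
    finally have "cmod (LINT x|M. of_real (\<phi> (r x)) * u x) \<le> (LINT x|M. cmod (v x))"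
      by (simp add: integral_norm_bound)
    also have "\<dots> \<le> (LINT x|M. \<epsilon> * cmod (u x))"
      by (rule integral_mono_AE) (use v_int \<epsilon>u v_le in auto)
    also have "\<dots> = \<epsilon> * K" by (simp add: K_def)
    finally show ?thesis .
  qed
  have "0 \<le> K" by (simp add: K_def)
  have "cmod (LINT x|M. of_real (\<phi> (r x)) * u x) \<le> 0"
  proof (rule field_le_epsilon)
    fix \<delta> :: real assume \<delta>: "0 < \<delta>"
    have "\<delta> / (K + 1) * K \<le> \<delta>" using \<delta> \<open>0 \<le> K\<close> by (simp add: field_simps)
    thus "cmod (LINT x|M. of_real (\<phi> (r x)) * u x) \<le> 0 + \<delta>"
      using le[of "\<delta> / (K + 1)"] \<delta> \<open>0 \<le> K\<close> by simp
  qed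
  thus ?thesis by simp
qed

text \<open>An operator that commutes with multiplication by \<open>e\<close> commutes with all powers of \<open>e\<close>; on
  matrix elements this says that two complex measures have the same moments in \<open>e\<close>, so the powers may
  be replaced by the square root.\<close>

lemma commutes_with_sqrt:
  assumes T: "T \<in> bounded_ops (L2_space M)" and e: "e \<in> effects (Linf_algebra M)"
    and comm: "compose (L2 M) T (mult_rep M e) = compose (L2 M) (mult_rep M e) T"
  shows "compose (L2 M) T (mult_rep M (cls_sqrt M e)) = compose (L2 M) (mult_rep M (cls_sqrt M e)) T"
proof (rule L2.bounded_op_eqI)
  note e_Linf = effect_Linf(2)[OF e] and e_range = effect_Linf(3)[OF e]
  have s_Linf: "cls_sqrt M e \<in> Linf M" by (rule Linf_sqrt_closed[OF e_Linf e_Linf])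
  note s_ops = mult_rep_in_ops[OF s_Linf]
  show "compose (L2 M) T (mult_rep M (cls_sqrt M e)) \<in> bounded_ops (L2_space M)"
    "compose (L2 M) (mult_rep M (cls_sqrt M e)) T \<in> bounded_ops (L2_space M)"
    using L2.compose_in_ops[OF T s_ops] L2.compose_in_ops[OF s_ops T] by simp_all
  fix g h assume "g \<in> carrier (L2_space M)" "h \<in> carrier (L2_space M)"
  hence g: "g \<in> L2 M" and h: "h \<in> L2 M" by simp_all
  have T_closed: "T k \<in> L2 M" if "k \<in> L2 M" for k using L2.bounded_opD(1)[OF T] that by simp
  define h' where "h' = op_adjoint (L2_space M) T h"
  have h': "h' \<in> L2 M"
    using L2.bounded_opD(1)[OF L2.op_adjoint_in_ops[OF T]] h by (simp add: h'_def)
  have adj: "vinner (L2_space M) h' k = vinner (L2_space M) h (T k)" if "k \<in> L2 M" for k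
    using L2.vinner_op_adjoint[OF T, of h k] h that by (simp only: h'_def L2_space_simps)
  define r where "r x = Re (repr e x)" for x
  define u where "u x = cnj (repr h' x) * repr g x - cnj (repr h x) * repr (T g) x" for x
  note [measurable] = repr_measurable[OF LinfD[OF e_Linf]] repr_measurable[OF LinfD[OF s_Linf]]
    repr_measurable[OF L2_fclass[OF g]] repr_measurable[OF L2_fclass[OF h]]
    repr_measurable[OF L2_fclass[OF h']] repr_measurable[OF L2_fclass[OF T_closed[OF g]]]
  have r [measurable]: "r \<in> borel_measurable M" unfolding r_def[abs_def] by measurable
  have u_int: "integrable M u"
    unfolding u_def[abs_def]
    by (intro Bochner_Integration.integrable_diff integrable_cnj_mult L2_sq_integrable g h h' T_closed)
  have range: "AE x in M. 0 \<le> r x \<and> r x \<le> 1"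
    using e_range by eventually_elim (simp add: r_def)
  \<comment> \<open>Integrals against \<open>u\<close> measure the failure of \<open>T\<close> to commute with multiplication by \<open>f\<close>.\<close>
  have commutator: "(LINT x|M. of_real (\<psi> (r x)) * u x) =
      vinner (L2_space M) h' k - vinner (L2_space M) h l"
    if k: "k \<in> L2 M" "AE x in M. repr k x = of_real (\<psi> (r x)) * repr g x"
      and l: "l \<in> L2 M" "AE x in M. repr l x = of_real (\<psi> (r x)) * repr (T g) x"
      and \<psi> [measurable]: "\<psi> \<in> borel_measurable borel" for \<psi> k l
  proof -
    note [measurable] = repr_measurable[OF L2_fclass[OF k(1)]] repr_measurable[OF L2_fclass[OF l(1)]]
    have "vinner (L2_space M) h' k - vinner (L2_space M) h l =
        (LINT x|M. cnj (repr h' x) * repr k x - cnj (repr h x) * repr l x)"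
      unfolding L2_space_simps
      by (rule Bochner_Integration.integral_diff[symmetric])
         (intro integrable_cnj_mult L2_sq_integrable h h' k(1) l(1))+
    also have "\<dots> = (LINT x|M. of_real (\<psi> (r x)) * u x)"
    proof (rule integral_cong_AE)
      show "AE x in M. cnj (repr h' x) * repr k x - cnj (repr h x) * repr l x =
          of_real (\<psi> (r x)) * u x"
        using k(2) l(2) by eventually_elim (simp add: u_def algebra_simps)
      show "(\<lambda>x. of_real (\<psi> (r x)) * u x) \<in> borel_measurable M"
        unfolding u_def by measurable
    qed measurable
    finally show ?thesis ..
  qed
  have pow: "(mult_rep M e ^^ n) k \<in> L2 M \<and>
      (AE x in M. repr ((mult_rep M e ^^ n) k) x = of_real (r x ^ n) * repr k x)"
    if k: "k \<in> L2 M" for k n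
  proof (induction n)
    case 0
    show ?case using k by simp
  next
    case (Suc n)
    hence kn: "(mult_rep M e ^^ n) k \<in> L2 M"
      and ae: "AE x in M. repr ((mult_rep M e ^^ n) k) x = of_real (r x ^ n) * repr k x" by simp_all
    have "AE x in M. repr ((mult_rep M e ^^ Suc n) k) x = of_real (r x ^ Suc n) * repr k x"
      using repr_mult_rep[OF e_Linf kn] ae e_range by eventually_elim (simp add: r_def)
    thus ?case using mult_rep_closed[OF e_Linf kn] by simp
  qed
  have T_pow: "T ((mult_rep M e ^^ n) g) = (mult_rep M e ^^ n) (T g)" for n
  proof (induction n)
    case (Suc n)
    have "T (mult_rep M e k) = mult_rep M e (T k)" if "k \<in> L2 M" for k
      using fun_cong[OF comm, of k] that by (simp add: compose_def)
    thus ?case using Suc pow[OF g, of n] by simp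
  qed simp
  have moments: "(LINT x|M. of_real (r x ^ n) * u x) = 0" for n
  proof -
    note k = pow[OF g, of n] and l = pow[OF T_closed[OF g], of n]
    have "(LINT x|M. of_real (r x ^ n) * u x) = vinner (L2_space M) h' ((mult_rep M e ^^ n) g) -
        vinner (L2_space M) h ((mult_rep M e ^^ n) (T g))"
      by (rule commutator[where \<psi> = "\<lambda>t. t ^ n"]) (use k l in simp_all)
    thus ?thesis using adj[OF k[THEN conjunct1]] T_pow[of n] by simp
  qed
  have "(LINT x|M. of_real (sqrt (r x)) * u x) = 0"
    by (rule moments_zero_imp[OF u_int r range moments]) (intro continuous_intros)
  moreover have "(LINT x|M. of_real (sqrt (r x)) * u x) =
      vinner (L2_space M) h' (mult_rep M (cls_sqrt M e) g) -
      vinner (L2_space M) h (mult_rep M (cls_sqrt M e) (T g))"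
  proof (rule commutator)
    have s: "AE x in M. repr (mult_rep M (cls_sqrt M e) k) x = of_real (sqrt (r x)) * repr k x"
      if "k \<in> L2 M" for k
      using repr_mult_rep[OF s_Linf that] repr_sqrt[OF LinfD[OF e_Linf]]
      by eventually_elim (simp add: r_def)
    show "AE x in M. repr (mult_rep M (cls_sqrt M e) g) x = of_real (sqrt (r x)) * repr g x"
      "AE x in M. repr (mult_rep M (cls_sqrt M e) (T g)) x = of_real (sqrt (r x)) * repr (T g) x"
      by (intro s g T_closed)+
  qed (auto intro!: mult_rep_closed[OF s_Linf] g T_closed)
  ultimately have "vinner (L2_space M) h (T (mult_rep M (cls_sqrt M e) g)) =
      vinner (L2_space M) h (mult_rep M (cls_sqrt M e) (T g))"
    using adj[OF mult_rep_closed[OF s_Linf g]] by simp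
  thus "vinner (L2_space M) h (compose (L2 M) T (mult_rep M (cls_sqrt M e)) g) =
      vinner (L2_space M) h (compose (L2 M) (mult_rep M (cls_sqrt M e)) T g)"
    using g by (simp add: compose_def)
qed

text \<open>A positive \<open>T\<close> with \<open>T\<^sup>2 = \<pi> e\<close> commutes with \<open>\<pi> e\<close>, hence with \<open>\<pi> (sqrt e)\<close>, and commuting positive
  roots coincide.\<close>

lemma pos_sqrt_mult_rep:
  assumes e: "e \<in> effects (Linf_algebra M)"
  shows mult_rep_sqrt_positive: "mult_rep M (cls_sqrt M e) \<in> positives (op_star_ring (L2_space M))"
    and mult_rep_sqrt_square:
      "compose (L2 M) (mult_rep M (cls_sqrt M e)) (mult_rep M (cls_sqrt M e)) = mult_rep M e"
    and "pos_sqrt (op_star_ring (L2_space M)) (mult_rep M e) = mult_rep M (cls_sqrt M e)"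
proof -
  note e_pos = effect_Linf(1)[OF e] and e_Linf = effect_Linf(2)[OF e]
  have nonneg: "AE x in M. repr e x \<in> \<real>\<^sub>\<ge>\<^sub>0" using e_pos by (simp add: positives_Linf_iff)
  have s_Linf: "cls_sqrt M e \<in> Linf M" by (rule Linf_sqrt_closed[OF e_Linf e_Linf])
  have "cls_sqrt M e \<in> positives (Linf_algebra M)"
    using s_Linf cls_sqrt_nonneg[OF LinfD[OF e_Linf] nonneg] by (simp add: positives_Linf_iff)
  thus pos: "mult_rep M (cls_sqrt M e) \<in> positives (op_star_ring (L2_space M))"
    by (rule mult_rep_positive)
  show sq: "compose (L2 M) (mult_rep M (cls_sqrt M e)) (mult_rep M (cls_sqrt M e)) = mult_rep M e"
    using mult_rep_mult[OF s_Linf s_Linf] cls_sqrt_square[OF LinfD[OF e_Linf] nonneg] by simp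
  show "pos_sqrt (op_star_ring (L2_space M)) (mult_rep M e) = mult_rep M (cls_sqrt M e)"
  proof (rule L2.pos_sqrt_eqI[OF pos])
    fix T assume T: "T \<in> positives (op_star_ring (L2_space M))"
      and TT: "compose (carrier (L2_space M)) T T = mult_rep M e"
    have T_ops: "T \<in> bounded_ops (L2_space M)" using L2.positive_opE[OF T] by blast
    have "compose (L2 M) T (mult_rep M e) = compose (L2 M) (mult_rep M e) T"
      using L2.bounded_opD(1)[OF T_ops]
      by (auto simp: TT[symmetric] compose_def fun_eq_iff restrict_def)
    from commutes_with_sqrt[OF T_ops e this]
    show "compose (carrier (L2_space M)) T (mult_rep M (cls_sqrt M e)) =
        compose (carrier (L2_space M)) (mult_rep M (cls_sqrt M e)) T" by simp
  qed (use sq in simp)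
qed

section \<open>Conditioning commutes with the embedding of states\<close>

lemma cls_sqrt_density:
  assumes p: "p \<in> densities (Linf_algebra M)"
  shows cls_sqrt_density_L2: "cls_sqrt M p \<in> L2 M"
    and vinner_cls_sqrt_density: "vinner (L2_space M) (cls_sqrt M p) (cls_sqrt M p) = 1"
proof -
  have p_fc: "p \<in> fclasses M" and p_int: "integrable M (repr p)"
    and nonneg: "AE x in M. repr p x \<in> \<real>\<^sub>\<ge>\<^sub>0" and one: "(LINT x|M. repr p x) = 1"
    using p by (simp_all add: L1_iff)
  note [measurable] = repr_measurable[OF p_fc] repr_measurable[OF cls_sqrt_closed[OF p_fc]]
  have eq: "AE x in M. complex_of_real ((cmod (repr (cls_sqrt M p) x))\<^sup>2) = repr p x"
    using repr_sqrt[OF p_fc] nonneg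
    by eventually_elim (auto elim!: nonneg_Reals_cases simp flip: of_real_power)
  have "integrable M (\<lambda>x. complex_of_real ((cmod (repr (cls_sqrt M p) x))\<^sup>2))"
    by (rule integrable_cong_AE_imp[OF p_int]) (measurable, use eq in \<open>auto elim!: eventually_mono\<close>)
  hence sq: "sq_integrable M (repr (cls_sqrt M p))"
    by (simp only: complex_of_real_integrable_eq sq_integrable_def)
       (simp add: repr_measurable[OF cls_sqrt_closed[OF p_fc]])
  thus "cls_sqrt M p \<in> L2 M" by (simp add: L2_iff cls_sqrt_closed[OF p_fc])
  have "(LINT x|M. complex_of_real ((cmod (repr (cls_sqrt M p) x))\<^sup>2)) = (LINT x|M. repr p x)"
    by (rule integral_cong_AE) (measurable, use eq in auto)
  thus "vinner (L2_space M) (cls_sqrt M p) (cls_sqrt M p) = 1"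
    unfolding L2_space_simps integral_norm_sq[OF sq] by (simp only: integral_complex_of_real one)
qed

lemma cond_density_Linf:
  assumes p: "p \<in> densities (Linf_algebra M)" and e: "e \<in> effects (Linf_algebra M)"
    and nz: "induced_state (Linf_algebra M) p e \<noteq> 0"
  obtains r where "0 < r" "induced_state (Linf_algebra M) p e = of_real r"
    and "cond_density (Linf_algebra M) p e \<in> densities (Linf_algebra M)"
    and "AE x in M. repr (cond_density (Linf_algebra M) p e) x =
      of_real (Re (repr e x) * Re (repr p x) / r)"
proof -
  note e_pos = effect_Linf(1)[OF e] and e_Linf = effect_Linf(2)[OF e] and e_range = effect_Linf(3)[OF e]
  note e_fc = LinfD[OF e_Linf]
  have p_fc: "p \<in> fclasses M" and p_int: "integrable M (repr p)"
    and nonneg: "AE x in M. repr p x \<in> \<real>\<^sub>\<ge>\<^sub>0"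
    using p by (simp_all add: L1_iff)
  note [measurable] = repr_measurable[OF p_fc] repr_measurable[OF e_fc]
  define w where "w x = Re (repr e x) * Re (repr p x)" for x
  have [measurable]: "w \<in> borel_measurable M" unfolding w_def[abs_def] by measurable
  have w_nonneg: "AE x in M. 0 \<le> w x"
    using e_range nonneg by eventually_elim (auto simp: w_def complex_nonneg_Reals_iff)
  have w_int: "integrable M w"
  proof (rule Bochner_Integration.integrable_bound[OF p_int])
    show "AE x in M. norm (w x) \<le> norm (repr p x)"
      using e_range nonneg
      by eventually_elim
         (auto simp: w_def abs_mult elim!: nonneg_Reals_cases intro!: mult_left_le_one_le)
  qed measurable
  define r where "r = (LINT x|M. w x)"
  have "(LINT x|M. repr e x * repr p x) = (LINT x|M. complex_of_real (w x))"
  proof (rule integral_cong_AE)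
    show "AE x in M. repr e x * repr p x = complex_of_real (w x)"
      using e_range nonneg
      by eventually_elim (auto simp: w_def complex_nonneg_Reals_iff complex_eq_iff)
  qed measurable
  also have "\<dots> = of_real r" by (simp add: r_def)
  finally have validity: "induced_state (Linf_algebra M) p e = of_real r"
    using e_Linf by (simp add: induced_state_def)
  have "0 \<le> r" unfolding r_def by (rule integral_nonneg_AE[OF w_nonneg])
  hence r: "0 < r" using nz validity by auto
  define s where "s = cls_sqrt M e"
  have s: "s \<in> fclasses M" unfolding s_def by (rule cls_sqrt_closed[OF e_fc])
  have sp: "cls_mult M s p \<in> fclasses M" by (rule cls_mult_closed[OF s p_fc])
  have sps: "cls_mult M (cls_mult M s p) s \<in> fclasses M" by (rule cls_mult_closed[OF sp s])
  define q where "q = cond_density (Linf_algebra M) p e"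
  have q_eq: "q = cls_scale M (1 / of_real r) (cls_mult M (cls_mult M s p) s)"
    by (simp add: q_def cond_density_def validity pos_sqrt_Linf[OF e_pos] s_def)
  have q_fc: "q \<in> fclasses M" unfolding q_eq by (rule cls_scale_closed[OF sps])
  note [measurable] = repr_measurable[OF q_fc]
  have q_ae: "AE x in M. repr q x = of_real (w x / r)"
    using repr_scale[OF sps, of "1 / of_real r"] repr_mult[OF sp s] repr_mult[OF s p_fc]
      repr_sqrt[OF e_fc] e_range nonneg
    unfolding q_eq s_def[symmetric]
  proof eventually_elim
    case (elim x)
    have "complex_of_real (sqrt (Re (repr e x))) * of_real (sqrt (Re (repr e x))) = of_real (Re (repr e x))"
      using elim by (simp flip: of_real_mult)
    moreover have "repr p x = of_real (Re (repr p x))"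
      using elim by (simp add: complex_nonneg_Reals_iff complex_eq_iff)
    ultimately show ?case using elim by (simp add: w_def)
  qed
  have wr_int: "integrable M (\<lambda>x. complex_of_real (w x / r))"
    unfolding complex_of_real_integrable_eq using w_int by simp
  have "integrable M (repr q)"
    by (rule integrable_cong_AE_imp[OF wr_int]) (measurable, use q_ae in \<open>auto elim!: eventually_mono\<close>)
  moreover have "AE x in M. repr q x \<in> \<real>\<^sub>\<ge>\<^sub>0"
    using q_ae w_nonneg by eventually_elim (use r in \<open>simp del: of_real_divide\<close>)
  moreover have "(LINT x|M. repr q x) = (LINT x|M. complex_of_real (w x / r))"
    by (rule integral_cong_AE) (measurable, use q_ae in auto)
  moreover have "(LINT x|M. complex_of_real (w x / r)) = 1"
    unfolding integral_complex_of_real using r by (simp add: r_def[symmetric])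
  ultimately have "q \<in> densities (Linf_algebra M)" using q_fc by (simp add: L1_iff)
  with r validity q_ae show ?thesis using that by (simp add: q_def w_def)
qed

lemma state_embedding_induced_state:
  assumes "p \<in> densities (Linf_algebra M)"
  shows "state_embedding M (induced_state (Linf_algebra M) p) =
    induced_state (BL2_algebra M) (rank_one (L2_space M) (cls_sqrt M p))"
  by (simp only: state_embedding_def density_of_Linf[OF assms])

text \<open>Both sides are the state of the projection onto one vector: the root of \<open>q = e p / r\<close> on the left,
  and the normalized image of \<open>sqrt p\<close> under the root of \<open>\<pi> e\<close> on the right.\<close>

lemma state_embedding_cond_state:
  assumes p: "p \<in> densities (Linf_algebra M)" and e: "e \<in> effects (Linf_algebra M)"
    and nz: "induced_state (Linf_algebra M) p e \<noteq> 0"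
  shows "state_embedding M (cond_state (Linf_algebra M) (induced_state (Linf_algebra M) p) e) =
    cond_state (BL2_algebra M) (state_embedding M (induced_state (Linf_algebra M) p)) (mult_rep M e)"
proof -
  obtain r where r: "0 < r" and validity: "induced_state (Linf_algebra M) p e = of_real r"
    and q: "cond_density (Linf_algebra M) p e \<in> densities (Linf_algebra M)"
    and q_ae: "AE x in M. repr (cond_density (Linf_algebra M) p e) x =
      of_real (Re (repr e x) * Re (repr p x) / r)"
    using cond_density_Linf[OF p e nz] by blast
  define q' where "q' = cond_density (Linf_algebra M) p e"
  define \<xi> where "\<xi> = cls_sqrt M p"
  define S where "S = mult_rep M (cls_sqrt M e)"
  note e_Linf = effect_Linf(2)[OF e] and e_range = effect_Linf(3)[OF e]
  have p_fc: "p \<in> fclasses M" and nonneg: "AE x in M. repr p x \<in> \<real>\<^sub>\<ge>\<^sub>0"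
    using p by (simp_all add: L1_iff)
  have q_fc: "q' \<in> fclasses M" using q by (simp add: L1_iff q'_def)
  have s_Linf: "cls_sqrt M e \<in> Linf M" by (rule Linf_sqrt_closed[OF e_Linf e_Linf])
  have \<xi>: "\<xi> \<in> L2 M" and unit: "vinner (L2_space M) \<xi> \<xi> = 1"
    unfolding \<xi>_def by (rule cls_sqrt_density[OF p])+
  have S\<xi>: "S \<xi> \<in> L2 M" unfolding S_def by (rule mult_rep_closed[OF s_Linf \<xi>])
  have \<xi>_ae: "AE x in M. repr \<xi> x = of_real (sqrt (Re (repr p x)))"
    unfolding \<xi>_def by (rule repr_sqrt[OF p_fc])
  have vec: "cls_sqrt M q' = vscale (L2_space M) (1 / of_real (sqrt r)) (S \<xi>)"
    unfolding L2_space_simps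
  proof (rule fclass_eqI[OF cls_sqrt_closed[OF q_fc] cls_scale_closed[OF L2_fclass[OF S\<xi>]]])
    show "AE x in M. repr (cls_sqrt M q') x = repr (cls_scale M (1 / of_real (sqrt r)) (S \<xi>)) x"
      using repr_sqrt[OF q_fc] q_ae[folded q'_def] repr_scale[OF L2_fclass[OF S\<xi>], of "1 / of_real (sqrt r)"]
        repr_mult_rep[OF s_Linf \<xi>, folded S_def] repr_sqrt[OF LinfD[OF e_Linf]] \<xi>_ae
      by eventually_elim (simp add: real_sqrt_mult real_sqrt_divide)
  qed
  note [measurable] = repr_measurable[OF p_fc] repr_measurable[OF LinfD[OF e_Linf]]
    repr_measurable[OF L2_fclass[OF \<xi>]]
  have "vinner (L2_space M) \<xi> (mult_rep M e \<xi>) = (LINT x|M. cnj (repr \<xi> x) * (repr e x * repr \<xi> x))"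
    by (rule vinner_mult_rep[OF e_Linf \<xi> \<xi>])
  also have "\<dots> = (LINT x|M. repr e x * repr p x)"
  proof (rule integral_cong_AE)
    show "AE x in M. cnj (repr \<xi> x) * (repr e x * repr \<xi> x) = repr e x * repr p x"
      using \<xi>_ae nonneg
    proof eventually_elim
      case (elim x)
      then obtain a where a: "repr p x = of_real a" "0 \<le> a" by (auto elim!: nonneg_Reals_cases)
      have "complex_of_real (sqrt a) * of_real (sqrt a) = of_real a"
        using a(2) by (simp flip: of_real_mult)
      thus ?case using elim a by (simp add: mult_ac)
    qed
  qed measurable
  also have "\<dots> = of_real r" using validity e_Linf by (simp add: induced_state_def)
  finally have r_eq: "vinner (L2_space M) \<xi> (mult_rep M e \<xi>) = of_real r" .
  have pure: "rank_one (L2_space M) \<xi> \<in> densities (BL2_algebra M)"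
    by (rule L2.rank_one_density) (use \<xi> unit in simp_all)
  have cond: "cond_density (BL2_algebra M) (rank_one (L2_space M) \<xi>) (mult_rep M e) =
      rank_one (L2_space M) (cls_sqrt M q')"
    unfolding vec
  proof (rule L2.cond_density_rank_one)
    show "S \<in> positives (op_star_ring (L2_space M))"
      "pos_sqrt (op_star_ring (L2_space M)) (mult_rep M e) = S"
      "compose (carrier (L2_space M)) S S = mult_rep M e"
      using pos_sqrt_mult_rep[OF e] by (simp_all add: S_def)
    show "vinner (L2_space M) \<xi> (mult_rep M e \<xi>) = of_real r" by (rule r_eq)
  qed (use \<xi> r mult_rep_in_ops[OF e_Linf] in simp_all)
  have "state_embedding M (cond_state (Linf_algebra M) (induced_state (Linf_algebra M) p) e) =
      state_embedding M (induced_state (Linf_algebra M) q')"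
    by (simp only: cond_state_def density_of_Linf[OF p] q'_def)
  also have "\<dots> = induced_state (BL2_algebra M) (rank_one (L2_space M) (cls_sqrt M q'))"
    by (rule state_embedding_induced_state) (use q in \<open>simp add: q'_def\<close>)
  also have "\<dots> = cond_state (BL2_algebra M)
      (state_embedding M (induced_state (Linf_algebra M) p)) (mult_rep M e)"
    by (simp only: cond_state_def state_embedding_induced_state[OF p] \<xi>_def[symmetric]
        L2.density_of_op_algebra[OF pure] cond)
  finally show ?thesis .
qed

theorem mainTheorem2:
  fixes \<mu> :: "'x::topological_space measure" and \<Phi> :: "real \<Rightarrow> 'x \<Rightarrow> 'x"
  assumes "completely_metrizable_space (euclidean :: 'x topology)"
    and "separable_space (euclidean :: 'x topology)"
    and "sets \<mu> = sets borel"
    and "prob_space \<mu>"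
    and "ergodic_flow \<mu> \<Phi>"
  shows "mult_rep \<mu> ` effects (Linf_algebra \<mu>) \<subseteq> effects (BL2_algebra \<mu>) \<and>
    (\<forall>\<omega>\<in>normal_states (Linf_algebra \<mu>). \<forall>e\<in>effects (Linf_algebra \<mu>). \<omega> e \<noteq> 0 \<longrightarrow>
       state_embedding \<mu> (cond_state (Linf_algebra \<mu>) \<omega> e) =
       cond_state (BL2_algebra \<mu>) (state_embedding \<mu> \<omega>) (mult_rep \<mu> e))"
proof (intro conjI ballI impI)
  show "mult_rep \<mu> ` effects (Linf_algebra \<mu>) \<subseteq> effects (BL2_algebra \<mu>)"
    using mult_rep_effects by blast
  fix \<omega> e assume "\<omega> \<in> normal_states (Linf_algebra \<mu>)" and e: "e \<in> effects (Linf_algebra \<mu>)"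
    and nz: "\<omega> e \<noteq> 0"
  then obtain p where "p \<in> densities (Linf_algebra \<mu>)" "\<omega> = induced_state (Linf_algebra \<mu>) p"
    unfolding normal_states_def by blast
  with e nz show "state_embedding \<mu> (cond_state (Linf_algebra \<mu>) \<omega> e) =
      cond_state (BL2_algebra \<mu>) (state_embedding \<mu> \<omega>) (mult_rep \<mu> e)"
    using state_embedding_cond_state by blast
qed

end
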